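(* Let $n\ge2$ be an integer, $1<p<n$, $p_*=\frac{(n-1)p}{n-p}$, and let $\alpha\in\mathbb{R}$ with $\alpha<p_*-1$. Then $-\Delta_p^H u=u^\alpha$ in $\mathbb{R}^n$ has no positive supersolution.
   Context: $H\in C^2(\mathbb{R}^n\setminus\{0\})\cap C(\mathbb{R}^n)$ is a fixed positively homogeneous function of degree one ($H(t\xi)=tH(\xi)$ for $t>0$, $H(0)=0$), positive on $\mathbb{S}^{n-1}$ (not assumed even), and uniformly convex, i.e. the unit ball $\{\xi: H(\xi)<1\}$ is uniformly convex (its boundary has principal curvatures bounded below by a positive constant). Set $a(\xi)=\frac1p\nabla_\xi H^p(\xi)$ (with $a(0)=0$) and $\Delta_p^H u=\operatorname{div}(a(\nabla u))$. A positive supersolution of $-\Delta_p^H u=u^\alpha$ in $\mathbb{R}^n$ is a function $u\in W^{1,p}_{\mathrm{loc}}(\mathbb{R}^n)\cap C(\mathbb{R}^n)$ with $u>0$ in $\mathbb{R}^n$ such that $\int_{\mathbb{R}^n}a(\nabla u)\cdot\nabla\varphi\ge\int_{\mathbb{R}^n}u^\alpha\varphi$ for all $\varphi\in C_c^\infty(\mathbb{R}^n)$ with $\varphi\ge0$. *)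

theory Defs
  imports "HOL-Analysis.Analysis"
begin

section \<open>Classical differentiability\<close>

text \<open>Junk value where the function is not differentiable.\<close>

definition gradient :: "('a::euclidean_space \<Rightarrow> real) \<Rightarrow> 'a \<Rightarrow> 'a" where
  "gradient f x = (THE D. GDERIV f x :> D)"

lemma gradient_eqI:
  assumes "GDERIV f x :> D"
  shows "gradient f x = D"
  unfolding gradient_def
proof (rule the_equality)
  fix E assume "GDERIV f x :> E"
  then have "(\<lambda>h. h \<bullet> E) = (\<lambda>h. h \<bullet> D)"
    using assms unfolding gderiv_def by (rule has_derivative_unique)
  then show "E = D"
    by (metis inner_commute vector_eq_rdot)
qed (rule assms)

text \<open>Meant for open \<open>S\<close>. Iterated partial derivatives are read off the Frechet derivative,
  so differentiability is required at every stage below the last; for continuous partial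
  derivatives this is automatic.\<close>

fun Ck_on :: "nat \<Rightarrow> ('a::euclidean_space \<Rightarrow> real) \<Rightarrow> 'a set \<Rightarrow> bool" where
  "Ck_on 0 f S \<longleftrightarrow> continuous_on S f"
| "Ck_on (Suc k) f S \<longleftrightarrow> (\<forall>x\<in>S. f differentiable (at x)) \<and>
     (\<forall>b\<in>Basis. Ck_on k (\<lambda>x. frechet_derivative f (at x) b) S)"

definition test_function :: "('a::euclidean_space \<Rightarrow> real) \<Rightarrow> bool" where
  "test_function \<phi> \<longleftrightarrow> (\<forall>k. Ck_on k \<phi> UNIV) \<and> compact (closure {x. \<phi> x \<noteq> 0})"

section \<open>Local Sobolev spaces\<close>

definition Lp_loc :: "real \<Rightarrow> ('a::euclidean_space \<Rightarrow> 'b::euclidean_space) \<Rightarrow> bool" where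
  "Lp_loc p f \<longleftrightarrow> f \<in> borel_measurable lebesgue \<and>
     (\<forall>K. compact K \<longrightarrow> set_integrable lebesgue K (\<lambda>x. norm (f x) powr p))"

definition has_weak_gradient ::
    "('a::euclidean_space \<Rightarrow> real) \<Rightarrow> ('a \<Rightarrow> 'a) \<Rightarrow> bool" where
  "has_weak_gradient u G \<longleftrightarrow> Lp_loc 1 u \<and> Lp_loc 1 G \<and>
     (\<forall>\<phi>. test_function \<phi> \<longrightarrow>
        (LINT x|lebesgue. u x *\<^sub>R gradient \<phi> x) = - (LINT x|lebesgue. \<phi> x *\<^sub>R G x))"

text \<open>Weak gradients are unique only up to null sets; an arbitrary representative is
  chosen.\<close>

definition weak_gradient :: "('a::euclidean_space \<Rightarrow> real) \<Rightarrow> 'a \<Rightarrow> 'a" where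
  "weak_gradient u = (SOME G. has_weak_gradient u G)"

definition W1p_loc :: "real \<Rightarrow> ('a::euclidean_space \<Rightarrow> real) set" where
  "W1p_loc p = {u. Lp_loc p u \<and> (\<exists>G. has_weak_gradient u G \<and> Lp_loc p G)}"

section \<open>The anisotropy and its operator\<close>

text \<open>Outward unit normal to the sublevel domains of \<open>F\<close>, as a vector field on the region
  where \<open>F\<close> is differentiable with nonvanishing gradient.\<close>

definition outward_normal :: "('a::euclidean_space \<Rightarrow> real) \<Rightarrow> 'a \<Rightarrow> 'a" where
  "outward_normal F x = gradient F x /\<^sub>R norm (gradient F x)"

text \<open>The principal curvatures at \<open>x\<close> of the level hypersurface of \<open>F\<close> through \<open>x\<close> are the
  eigenvalues of the Weingarten map, the differential of the unit normal restricted to the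
  tangent space. With the outward normal, the unit sphere has principal curvatures \<open>+1\<close>.\<close>

definition principal_curvature :: "('a::euclidean_space \<Rightarrow> real) \<Rightarrow> 'a \<Rightarrow> real \<Rightarrow> bool" where
  "principal_curvature F x \<kappa> \<longleftrightarrow>
     (\<exists>v. v \<noteq> 0 \<and> v \<bullet> outward_normal F x = 0 \<and>
          frechet_derivative (outward_normal F) (at x) v = \<kappa> *\<^sub>R v)"

definition uniformly_convex :: "('a::euclidean_space \<Rightarrow> real) \<Rightarrow> bool" where
  "uniformly_convex H \<longleftrightarrow>
     (\<exists>\<kappa>\<^sub>0>0. \<forall>x\<in>frontier {\<xi>. H \<xi> < 1}. \<forall>\<kappa>. principal_curvature H x \<kappa> \<longrightarrow> \<kappa>\<^sub>0 \<le> \<kappa>)"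

definition admissible_anisotropy :: "('a::euclidean_space \<Rightarrow> real) \<Rightarrow> bool" where
  "admissible_anisotropy H \<longleftrightarrow>
     Ck_on 2 H (- {0}) \<and> continuous_on UNIV H \<and>
     (\<forall>t>0. \<forall>\<xi>. H (t *\<^sub>R \<xi>) = t * H \<xi>) \<and> H 0 = 0 \<and>
     (\<forall>\<xi>\<in>sphere 0 1. 0 < H \<xi>) \<and>
     uniformly_convex H"

definition anisotropic_field :: "('a::euclidean_space \<Rightarrow> real) \<Rightarrow> real \<Rightarrow> 'a \<Rightarrow> 'a" where
  "anisotropic_field H p \<xi> =
     (if \<xi> = 0 then 0 else (1 / p) *\<^sub>R gradient (\<lambda>\<eta>. H \<eta> powr p) \<xi>)"

definition positive_supersolution ::
    "('a::euclidean_space \<Rightarrow> real) \<Rightarrow> real \<Rightarrow> real \<Rightarrow> ('a \<Rightarrow> real) \<Rightarrow> bool" where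
  "positive_supersolution H p \<alpha> u \<longleftrightarrow>
     u \<in> W1p_loc p \<and> continuous_on UNIV u \<and> (\<forall>x. 0 < u x) \<and>
     (\<forall>\<phi>. test_function \<phi> \<and> (\<forall>x. 0 \<le> \<phi> x) \<longrightarrow>
        (LINT x|lebesgue. anisotropic_field H p (weak_gradient u x) \<bullet> gradient \<phi> x)
          \<ge> (LINT x|lebesgue. u x powr \<alpha> * \<phi> x))"

end

theory Submission
  imports Defs
begin

text \<open>Let \<open>V = a(\<nabla>u)\<close>, so that \<open>\<bar>V\<bar> \<le> C \<bar>\<nabla>u\<bar>\<^sup>p\<^sup>-\<^sup>1\<close> and \<open>V \<bullet> \<nabla>u \<ge> c \<bar>\<nabla>u\<bar>\<^sup>p\<close> by homogeneity and
  Euler's identity. The test function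
  \<open>(\<rho>\<^sub>j * u) powr (-\<delta>) \<cdot> \<eta>\<^sub>R ^ k\<close> is smooth, where \<open>\<rho>\<^sub>j\<close> is a mollifier and \<open>\<eta>\<^sub>R\<close> a cutoff at scale \<open>R\<close>.
  Strong local convergence of \<open>\<rho>\<^sub>j * \<nabla>u\<close> in the Lebesgue space of order \<open>p\<close> lets \<open>j\<close> tend to infinity.
  With \<open>\<theta>\<close> determined by \<open>p - 1 - \<delta> = \<theta> (\<alpha> - \<delta>)\<close>, two applications of Young's inequality bound
  \<open>\<integral> u powr (\<alpha> - \<delta>) \<cdot> \<eta>\<^sub>R ^ k\<close> by a multiple of \<open>\<integral> \<bar>\<nabla>\<eta>\<^sub>R\<bar> powr (p / (1 - \<theta>))\<close>, hence by a multiple of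
  \<open>R powr (n - p / (1 - \<theta>))\<close>. Below the critical exponent \<open>\<delta>\<close> can be chosen so that this power of \<open>R\<close> is
  negative: small if \<open>\<alpha> > p - 1\<close>, large if \<open>\<alpha> < p - 1\<close>, and \<open>\<delta> = p - 1\<close> (with \<open>\<theta>\<close> free) if
  \<open>\<alpha> = p - 1\<close>. Letting \<open>R\<close> tend to infinity contradicts the positivity of \<open>u\<close>.\<close>

section \<open>Differential calculus for iterated partial derivatives\<close>

text \<open>The supersolution inequality may only be tested with smooth functions of compact
  support, while \<open>u\<close> is merely continuous and weakly differentiable. Mollifying
  \<open>u\<close> itself, not the finished test function, keeps the powers explicit:
  \<open>conv (\<rho> j) u\<close> is smooth and positive, and continuity of \<open>u\<close> bounds
  it below on a fixed ball uniformly in \<open>j\<close>, so its negative powers stay bounded. The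
  field \<open>V\<close> is never mollified.

  A second obstacle is that \<open>weak_gradient u\<close> is an arbitrary choice among the locally
  integrable weak gradients. Its local integrability to the power \<open>p\<close> follows only from
  a.e. uniqueness, which again comes from mollification.

  The critical exponent enters through \<open>q = p / (1 - \<theta>)\<close>. For \<alpha> > p - 1
  this equals \<open>p * (\<alpha> - \<delta>) / (\<alpha> - p + 1)\<close>; as \<delta> tends to 0,
  the condition \<open>n < q\<close> becomes \<open>\<alpha> * (n - p) < n * (p - 1)\<close>, which
  is exactly \<open>\<alpha> < (n - 1) * p / (n - p) - 1\<close>.\<close>

abbreviation smooth :: "('a::euclidean_space \<Rightarrow> real) \<Rightarrow> bool" where
  "smooth f \<equiv> \<forall>k. Ck_on k f UNIV"

text \<open>\<open>gradient\<close> is a definite description, so a witness is needed first: the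
  Riesz vector of the Frechet derivative, assembled from its values on the basis.\<close>

lemma GDERIV_gradient:
  assumes "f differentiable (at x)"
  shows "GDERIV f x :> gradient f x"
proof -
  have lin: "bounded_linear (frechet_derivative f (at x))"
    and fd: "(f has_derivative frechet_derivative f (at x)) (at x)"
    using assms frechet_derivative_works has_derivative_bounded_linear by blast+
  define D where "D = (\<Sum>b\<in>Basis. frechet_derivative f (at x) b *\<^sub>R b)"
  have "frechet_derivative f (at x) h = h \<bullet> D" for h
  proof -
    have "frechet_derivative f (at x) (\<Sum>b\<in>Basis. (h \<bullet> b) *\<^sub>R b) = h \<bullet> D"
      unfolding D_def using bounded_linear.linear[OF lin]
      by (simp add: linear_sum linear_scale inner_sum_right mult.commute del: euclidean_representation)
    then show ?thesis by (simp add: euclidean_representation)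
  qed
  then have "frechet_derivative f (at x) = (\<lambda>h. h \<bullet> D)"
    by (rule ext)
  then have "GDERIV f x :> D"
    using fd by (simp add: gderiv_def)
  then show ?thesis
    using gradient_eqI by metis
qed

lemma GDERIV_differentiable: "GDERIV f x :> D \<Longrightarrow> f differentiable (at x)"
  by (auto simp: gderiv_def differentiable_def)

lemma frechet_derivative_GDERIV:
  "GDERIV f x :> D \<Longrightarrow> frechet_derivative f (at x) b = D \<bullet> b"
  unfolding gderiv_def by (metis frechet_derivative_at inner_commute)

text \<open>Trades Frechet derivatives for the components of an explicit gradient, so that the
  inductions below run on the \<open>GDERIV\<close> rules for sums, products and
  compositions.\<close>

lemma Ck_on_SucI:
  assumes "\<And>x. GDERIV f x :> D x" and "\<And>b. b \<in> Basis \<Longrightarrow> Ck_on k (\<lambda>x. D x \<bullet> b) UNIV"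
  shows "Ck_on (Suc k) f UNIV"
  using assms GDERIV_differentiable[OF assms(1)]
  by (auto simp: frechet_derivative_GDERIV[OF assms(1)])

lemma Ck_on_SucD:
  assumes "Ck_on (Suc k) f UNIV"
  shows "GDERIV f x :> gradient f x" and "b \<in> Basis \<Longrightarrow> Ck_on k (\<lambda>x. gradient f x \<bullet> b) UNIV"
proof -
  show *: "GDERIV f x :> gradient f x" for x
    using assms by (auto intro: GDERIV_gradient)
  show "Ck_on k (\<lambda>x. gradient f x \<bullet> b) UNIV" if "b \<in> Basis"
    using assms that by (auto simp: frechet_derivative_GDERIV[OF *])
qed

text \<open>The recursion does not make \<open>Ck_on\<close> monotone in the order by definition,
  yet the product and chain rules multiply a derivative by an undifferentiated factor, which must be
  available at the lower order.\<close>

lemma Ck_on_Suc_imp: "Ck_on (Suc k) f UNIV \<Longrightarrow> Ck_on k f UNIV"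
proof (induction k arbitrary: f)
  case 0
  then show ?case
    by (auto intro: continuous_at_imp_continuous_on differentiable_imp_continuous_within)
next
  case (Suc k)
  then show ?case
    using Ck_on_SucD[OF Suc.prems] by (intro Ck_on_SucI[where D="gradient f"]) auto
qed

lemma Ck_on_const: "Ck_on k (\<lambda>x. c) UNIV"
proof (induction k arbitrary: c)
  case (Suc k)
  then show ?case by (intro Ck_on_SucI[where D="\<lambda>x. 0"] GDERIV_const) auto
qed auto

lemma Ck_on_add: "Ck_on k f UNIV \<Longrightarrow> Ck_on k g UNIV \<Longrightarrow> Ck_on k (\<lambda>x. f x + g x) UNIV"
proof (induction k arbitrary: f g)
  case (Suc k)
  show ?case
    using Ck_on_SucD[OF Suc.prems(1)] Ck_on_SucD[OF Suc.prems(2)]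
    by (intro Ck_on_SucI[where D="\<lambda>x. gradient f x + gradient g x"] GDERIV_add)
       (auto simp: inner_add_left intro: Suc.IH)
qed (auto intro: continuous_intros)

lemma Ck_on_sum:
  "(\<And>i. i \<in> I \<Longrightarrow> Ck_on k (f i) UNIV) \<Longrightarrow> Ck_on k (\<lambda>x. \<Sum>i\<in>I. f i x) UNIV"
  by (induction I rule: infinite_finite_induct) (auto intro: Ck_on_const Ck_on_add)

lemma Ck_on_mult: "Ck_on k f UNIV \<Longrightarrow> Ck_on k g UNIV \<Longrightarrow> Ck_on k (\<lambda>x. f x * g x) UNIV"
proof (induction k arbitrary: f g)
  case (Suc k)
  show ?case
    using Ck_on_SucD[OF Suc.prems(1)] Ck_on_SucD[OF Suc.prems(2)]
      Ck_on_Suc_imp[OF Suc.prems(1)] Ck_on_Suc_imp[OF Suc.prems(2)]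
    by (intro Ck_on_SucI[where D="\<lambda>x. f x *\<^sub>R gradient g x + g x *\<^sub>R gradient f x"] GDERIV_mult)
       (auto simp: inner_add_left intro!: Suc.IH Ck_on_add)
qed (auto intro: continuous_intros)

lemma Ck_on_power: "Ck_on k f UNIV \<Longrightarrow> Ck_on k (\<lambda>x. f x ^ m) UNIV"
  by (induction m) (auto intro: Ck_on_const Ck_on_mult)

lemma Ck_on_inner: "Ck_on k (\<lambda>x. x \<bullet> c) UNIV"
proof (cases k)
  case (Suc m)
  have "Ck_on (Suc m) (\<lambda>x. x \<bullet> c) UNIV"
    by (intro Ck_on_SucI[where D="\<lambda>x. c"])
       (auto intro!: Ck_on_const bounded_linear_imp_has_derivative bounded_linear_inner_left
         simp: gderiv_def)
  then show ?thesis using Suc by simp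
qed (auto intro: continuous_intros)

lemma GDERIV_affine:
  assumes "GDERIV f (c *\<^sub>R x + d) :> D"
  shows "GDERIV (\<lambda>x. f (c *\<^sub>R x + d)) x :> c *\<^sub>R D"
proof -
  have "((\<lambda>x. c *\<^sub>R x + d) has_derivative (\<lambda>h. c *\<^sub>R h)) (at x)"
    by (auto intro!: derivative_eq_intros)
  from has_derivative_compose[OF this assms[unfolded gderiv_def]]
  show ?thesis by (simp add: gderiv_def)
qed

lemma Ck_on_affine: "Ck_on k f UNIV \<Longrightarrow> Ck_on k (\<lambda>x. f (c *\<^sub>R x + d)) UNIV"
proof (induction k arbitrary: f)
  case 0
  then show ?case
    by (auto intro!: continuous_on_compose2[of UNIV f] continuous_intros)
next
  case (Suc k)
  show ?case
  proof (rule Ck_on_SucI)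
    show "GDERIV (\<lambda>x. f (c *\<^sub>R x + d)) x :> c *\<^sub>R gradient f (c *\<^sub>R x + d)" for x
      using Ck_on_SucD(1)[OF Suc.prems] by (rule GDERIV_affine)
    show "Ck_on k (\<lambda>x. (c *\<^sub>R gradient f (c *\<^sub>R x + d)) \<bullet> b) UNIV" if "b \<in> Basis" for b
      using Ck_on_mult[OF Ck_on_const Suc.IH[OF Ck_on_SucD(2)[OF Suc.prems that]], of c] by simp
  qed
qed

text \<open>Differentiating \<open>D j (f x)\<close> produces \<open>D (Suc j) (f x)\<close> times a
  gradient, so the induction carries the whole sequence of derivatives. The set \<open>T\<close>
  confines the hypothesis to the range of \<open>f\<close>, since \<open>powr\<close> needs
  positivity.\<close>

lemma Ck_on_compose_deriv_seq:
  assumes D: "\<And>j t. t \<in> T \<Longrightarrow> (D j has_field_derivative D (Suc j) t) (at t)"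
    and f: "Ck_on k f UNIV" and T: "\<And>x. f x \<in> T"
  shows "Ck_on k (\<lambda>x. D j (f x)) UNIV"
  using f T
proof (induction k arbitrary: j)
  case 0
  then have "isCont f x" for x by (simp add: continuous_on_eq_continuous_at)
  moreover have "isCont (D j) (f x)" for x
    using D 0 DERIV_isCont by blast
  ultimately show ?case
    by (auto simp: continuous_on_eq_continuous_at intro: isCont_o2)
next
  case (Suc k)
  show ?case
    using Ck_on_SucD[OF Suc.prems(1)] Ck_on_Suc_imp[OF Suc.prems(1)] Suc.prems(2)
    by (intro Ck_on_SucI[where D="\<lambda>x. D (Suc j) (f x) *\<^sub>R gradient f x"]
          GDERIV_DERIV_compose[where g="D j"] D)
       (auto intro!: Suc.IH Ck_on_mult)
qed

lemma smooth_powr: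
  assumes "smooth f" and "\<And>x. 0 < f x"
  shows "smooth (\<lambda>x. f x powr s)"
proof
  fix k
  \<comment> \<open>The \<open>j\<close>-th derivative of \<open>t powr s\<close>, with its falling
    factorial as coefficient.\<close>
  define D where "D j t = (\<Prod>i<j. s - real i) * t powr (s - real j)" for j and t :: real
  have "(D j has_field_derivative D (Suc j) t) (at t)" if "t \<in> {0<..}" for j t
    unfolding D_def using that
    by (auto intro!: derivative_eq_intros simp: algebra_simps)
  from Ck_on_compose_deriv_seq[of "{0<..}" D, OF this, of k f 0] assms
  show "Ck_on k (\<lambda>x. f x powr s) UNIV" by (simp add: D_def)
qed

section \<open>A smooth function on the line that vanishes exactly on the nonpositive reals\<close>

definition bump :: "real \<Rightarrow> real" where
  "bump t = (if 0 < t then exp (- inverse t) else 0)"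

lemma bump_props [simp]: "0 \<le> bump t" "bump t \<le> 1" "bump t = 0 \<longleftrightarrow> t \<le> 0" "0 < bump t \<longleftrightarrow> 0 < t"
  by (auto simp: bump_def)

text \<open>The \<open>j\<close>-th derivative of \<open>exp (- inverse t)\<close> is a polynomial in \<open>inverse t\<close> times the
  function itself.\<close>

fun bump_poly :: "nat \<Rightarrow> real poly" where
  "bump_poly 0 = 1"
| "bump_poly (Suc j) = [:0, 0, 1:] * (bump_poly j - pderiv (bump_poly j))"

definition bump_deriv :: "nat \<Rightarrow> real \<Rightarrow> real" where
  "bump_deriv j t = poly (bump_poly j) (inverse t) * bump t"

lemma poly_times_exp_tendsto_0: "((\<lambda>s::real. poly q s * exp (- s)) \<longlongrightarrow> 0) at_top"
proof -
  have "((\<lambda>s::real. \<Sum>i\<le>degree q. coeff q i * (s ^ i / exp s)) \<longlongrightarrow>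
      (\<Sum>i\<le>degree q. coeff q i * 0)) at_top"
    by (intro tendsto_intros tendsto_power_div_exp_0)
  then show ?thesis
    by (simp add: poly_altdef sum_distrib_right exp_minus divide_inverse mult.assoc)
qed

lemma bump_deriv_has_field_derivative:
  "(bump_deriv j has_field_derivative bump_deriv (Suc j) t) (at t)"
proof (cases t "0::real" rule: linorder_cases)
  case less
  have "((\<lambda>t. 0) has_field_derivative bump_deriv (Suc j) t) (at t)"
    using less by (simp add: bump_deriv_def bump_def)
  then show ?thesis
    by (rule has_field_derivative_transform_within_open[where S="{..<0}"])
       (use less in \<open>auto simp: bump_deriv_def bump_def\<close>)
next
  case equal
  have "((\<lambda>h. bump_deriv j h / h) \<longlongrightarrow> 0) (at_right 0)"
  proof -
    \<comment> \<open>Dividing by \<open>h\<close> multiplies by \<open>inverse h\<close>, that is,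
      shifts the coefficients by \<open>pCons 0\<close>. The difference quotient is again a
      polynomial times the exponential, with \<open>inverse h\<close> tending to infinity.\<close>
    have "((\<lambda>h::real. poly (pCons 0 (bump_poly j)) (inverse h) * exp (- inverse h)) \<longlongrightarrow> 0) (at_right 0)"
      by (rule filterlim_compose[OF poly_times_exp_tendsto_0 filterlim_inverse_at_top_right])
    then show ?thesis
      by (rule Lim_transform_eventually)
         (auto simp: eventually_at_filter bump_deriv_def bump_def field_simps)
  qed
  moreover have "((\<lambda>h. bump_deriv j h / h) \<longlongrightarrow> 0) (at_left 0)"
    by (rule Lim_transform_eventually[of "\<lambda>h. 0"])
       (auto simp: eventually_at_filter bump_deriv_def bump_def)
  ultimately have "((\<lambda>h. bump_deriv j h / h) \<longlongrightarrow> 0) (at 0)"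
    by (simp add: filterlim_split_at)
  then show ?thesis
    unfolding equal DERIV_def by (simp add: bump_deriv_def bump_def)
next
  case greater
  have "((\<lambda>t. poly (bump_poly j) (inverse t) * exp (- inverse t)) has_field_derivative bump_deriv (Suc j) t) (at t)"
    using greater
    by (auto intro!: derivative_eq_intros simp: bump_deriv_def bump_def power2_eq_square algebra_simps)
  then show ?thesis
    by (rule has_field_derivative_transform_within_open[where S="{0<..}"])
       (use greater in \<open>auto simp: bump_deriv_def bump_def\<close>)
qed

lemma smooth_bump: "smooth f \<Longrightarrow> smooth (\<lambda>x. bump (f x))"
  using Ck_on_compose_deriv_seq[of UNIV bump_deriv _ f 0] bump_deriv_has_field_derivative
  by (auto simp: bump_deriv_def)

section \<open>Local integrability and convolution\<close>

lemma smooth_GDERIV: "smooth f \<Longrightarrow> GDERIV f x :> gradient f x"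
  using Ck_on_SucD(1)[of 0 f] by blast

lemma smooth_gradient_inner: "smooth f \<Longrightarrow> b \<in> Basis \<Longrightarrow> smooth (\<lambda>x. gradient f x \<bullet> b)"
  using Ck_on_SucD(2) by blast

lemma smooth_continuous: "smooth f \<Longrightarrow> continuous_on A f"
  by (metis Ck_on.simps(1) continuous_on_subset subset_UNIV)

lemma smooth_gradient_continuous: "smooth f \<Longrightarrow> continuous_on A (gradient f)"
  by (subst continuous_on_componentwise) (use smooth_continuous smooth_gradient_inner in blast)

text \<open>The strict inequality describes an open set, on which the function is locally zero.
  Supports are handled in this form throughout, so closures appear only in the two conversion rules
  for \<open>test_function\<close>.\<close>

lemma gradient_zero_outside:
  assumes "\<And>x. R < norm x \<Longrightarrow> f x = 0" and "R < norm x"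
  shows "gradient f x = 0"
proof (rule gradient_eqI)
  have "open {x. R < norm x}"
    by (intro open_Collect_less continuous_intros)
  moreover have "((\<lambda>x. 0::real) has_derivative (\<lambda>h. h \<bullet> 0)) (at x)"
    by simp
  ultimately show "GDERIV f x :> 0"
    unfolding gderiv_def
    using has_derivative_transform_within_open[of "\<lambda>x. 0" _ x UNIV "{x. R < norm x}" f] assms
    by (simp del: has_derivative_const)
qed

lemma test_functionI:
  assumes "smooth f" and "\<And>x. R < norm x \<Longrightarrow> f x = 0"
  shows "test_function f"
proof -
  have "{x. f x \<noteq> 0} \<subseteq> cball 0 R"
    using assms(2) by (force simp: not_le[symmetric])
  then have "bounded {x. f x \<noteq> 0}"
    using bounded_cball bounded_subset by blast
  then show ?thesis
    using assms(1) by (simp add: test_function_def compact_closure)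
qed

lemma test_functionE:
  assumes "test_function f"
  obtains R where "smooth f" "0 < R" "\<And>x. R < norm x \<Longrightarrow> f x = 0"
proof -
  obtain R where R: "0 < R" "\<And>x. x \<in> closure {x. f x \<noteq> 0} \<Longrightarrow> norm x \<le> R"
    using assms by (metis bounded_pos compact_imp_bounded test_function_def)
  then have "f x = 0" if "R < norm x" for x
    using that closure_subset[of "{x. f x \<noteq> 0}"] by force
  then show ?thesis
    using that R assms unfolding test_function_def by blast
qed

lemma continuous_borel_lebesgue:
  "continuous_on UNIV f \<Longrightarrow> f \<in> borel_measurable lebesgue"
  using borel_measurable_continuous_onI[of f]
  by (intro measurable_completion) simp

lemma Lp_loc_continuous:
  assumes "continuous_on UNIV f" "0 \<le> p"
  shows "Lp_loc p f"
  unfolding Lp_loc_def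
proof (intro conjI allI impI)
  show "f \<in> borel_measurable lebesgue"
    using assms(1) by (rule continuous_borel_lebesgue)
  fix K :: "'a set" assume K: "compact K"
  have f: "continuous_on K f"
    using assms(1) continuous_on_subset by blast
  obtain M where M: "\<And>x. x \<in> K \<Longrightarrow> norm (f x) \<le> M"
    using compact_imp_bounded[OF compact_continuous_image[OF f K]] unfolding bounded_iff by auto
  have M2: "norm (f x) \<le> \<bar>M\<bar>" if "x \<in> K" for x
    using M[OF that] by linarith
  have [measurable]: "f \<in> borel_measurable lebesgue"
    using assms(1) by (rule continuous_borel_lebesgue)
  then have [measurable]: "(\<lambda>x. norm (f x) powr p) \<in> borel_measurable lebesgue"
    by measurable
  have [measurable]: "K \<in> sets lebesgue" and "emeasure lebesgue K < \<infinity>"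
    using K emeasure_compact_finite by (auto simp: compact_imp_closed)
  then have "integrable lebesgue (indicator K :: _ \<Rightarrow> real)"
    by (rule integrable_real_indicator)
  then have "integrable lebesgue (\<lambda>x. indicator K x *\<^sub>R (\<bar>M\<bar> powr p))"
    by simp
  then show "set_integrable lebesgue K (\<lambda>x. norm (f x) powr p)"
    unfolding set_integrable_def
    by (rule Bochner_Integration.integrable_bound)
       (use M2 assms(2) in \<open>auto intro!: powr_mono2 split: split_indicator\<close>)
qed

text \<open>Pointwise \<open>t \<le> 1 + t powr p\<close>, and compact sets have finite
  measure.\<close>

lemma Lp_loc_mono:
  assumes "Lp_loc p F" "1 \<le> p"
  shows "Lp_loc 1 F"
  unfolding Lp_loc_def
proof (intro conjI allI impI)
  show [measurable]: "F \<in> borel_measurable lebesgue"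
    using assms(1) by (simp add: Lp_loc_def)
  fix K :: "'a set" assume K: "compact K"
  have [measurable]: "K \<in> sets lebesgue" "emeasure lebesgue K < \<infinity>"
    using K emeasure_compact_finite by (auto simp: compact_imp_closed)
  have le: "norm (F x) \<le> 1 + norm (F x) powr p" for x
  proof (cases "norm (F x) \<le> 1")
    case False
    then show ?thesis using powr_mono[OF assms(2), of "norm (F x)"] by simp
  qed (simp add: add_increasing2)
  have "integrable lebesgue (\<lambda>x. indicator K x *\<^sub>R 1 + indicator K x *\<^sub>R (norm (F x) powr p))"
    using assms(1) K \<open>K \<in> sets lebesgue\<close> \<open>emeasure lebesgue K < \<infinity>\<close>
    by (intro Bochner_Integration.integrable_add) (auto simp: Lp_loc_def set_integrable_def)
  then show "set_integrable lebesgue K (\<lambda>x. norm (F x) powr 1)"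
    unfolding set_integrable_def
    by (rule Bochner_Integration.integrable_bound) (use le in \<open>auto simp: indicator_def\<close>)
qed

lemma integrable_cutoff:
  assumes F: "Lp_loc 1 F" and f: "f \<in> borel_measurable lebesgue"
    and M: "\<And>x. norm (f x) \<le> M" and R: "\<And>x. R < norm x \<Longrightarrow> f x = 0"
  shows "integrable lebesgue (\<lambda>x. f x *\<^sub>R F x)"
proof (rule Bochner_Integration.integrable_bound)
  show "integrable lebesgue (\<lambda>x. M * (indicator (cball 0 R) x *\<^sub>R norm (F x)))"
    using F by (auto simp: Lp_loc_def set_integrable_def)
  show "(\<lambda>x. f x *\<^sub>R F x) \<in> borel_measurable lebesgue"
    using F f by (intro borel_measurable_scaleR) (auto simp: Lp_loc_def)
  have "norm (f x *\<^sub>R F x) \<le> norm (M * (indicator (cball 0 R) x *\<^sub>R norm (F x)))" for x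
  proof (cases "norm x \<le> R")
    case True
    have "\<bar>f x\<bar> \<le> \<bar>M\<bar>" using M[of x] by simp
    then show ?thesis using True by (auto simp: abs_mult intro: mult_right_mono)
  qed (use R in auto)
  then show "AE x in lebesgue. norm (f x *\<^sub>R F x) \<le>
      norm (M * (indicator (cball 0 R) x *\<^sub>R norm (F x)))"
    by simp
qed

lemma bounded_if_support_bounded:
  fixes f :: "'a::euclidean_space \<Rightarrow> 'b::real_normed_vector"
  assumes "continuous_on UNIV f" and "\<And>x. R < norm x \<Longrightarrow> f x = 0"
  obtains M where "0 \<le> M" "\<And>x. norm (f x) \<le> M"
proof -
  have "compact (f ` cball 0 R)"
    using assms(1) by (intro compact_continuous_image) (auto intro: continuous_on_subset)
  then have "bounded (f ` cball 0 R)"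
    by (rule compact_imp_bounded)
  then obtain M where "0 < M" "\<forall>y\<in>f ` cball 0 R. norm y \<le> M"
    unfolding bounded_pos by blast
  then have M: "0 < M" "\<And>x. norm x \<le> R \<Longrightarrow> norm (f x) \<le> M"
    by auto
  then have "norm (f x) \<le> M" for x
    using assms(2)[of x] by (cases "norm x \<le> R") auto
  with M(1) show ?thesis by (intro that[of M]) auto
qed

lemma uniformly_continuous_if_support_bounded:
  fixes f :: "'a::euclidean_space \<Rightarrow> 'b::real_normed_vector"
  assumes f: "continuous_on UNIV f" and R: "\<And>x. R < norm x \<Longrightarrow> f x = 0"
  shows "uniformly_continuous_on UNIV f"
  unfolding uniformly_continuous_on_def
proof (intro allI impI)
  fix e :: real assume "0 < e"
  \<comment> \<open>The margin 1 settles mixed positions: two points at distance below 1 either both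
    lie in this larger ball or both lie beyond the support radius \<open>R\<close>.\<close>
  have "uniformly_continuous_on (cball 0 (R + 1)) f"
    using f by (intro compact_uniformly_continuous) (auto intro: continuous_on_subset)
  then obtain d where d: "0 < d"
    "\<And>x y. x \<in> cball 0 (R + 1) \<Longrightarrow> y \<in> cball 0 (R + 1) \<Longrightarrow> dist y x < d \<Longrightarrow> dist (f y) (f x) < e"
    using \<open>0 < e\<close> unfolding uniformly_continuous_on_def by meson
  have "dist (f y) (f x) < e" if xy: "dist y x < min d 1" for x y
  proof (cases "norm x \<le> R + 1 \<and> norm y \<le> R + 1")
    case True
    then show ?thesis using d(2) xy by simp
  next
    case False
    then have "R < norm x" "R < norm y"
      using xy norm_triangle_ineq2[of x y] norm_triangle_ineq2[of y x]
      by (auto simp: dist_norm norm_minus_commute)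
    then show ?thesis using R \<open>0 < e\<close> by simp
  qed
  then show "\<exists>d>0. \<forall>x\<in>UNIV. \<forall>y\<in>UNIV. dist y x < d \<longrightarrow> dist (f y) (f x) < e"
    using d(1) by (intro exI[of _ "min d 1"]) auto
qed

lemma integrable_cutoff_continuous:
  assumes F: "Lp_loc 1 F" and f: "continuous_on UNIV f"
    and R: "\<And>x. R < norm x \<Longrightarrow> f x = (0::real)"
  shows "integrable lebesgue (\<lambda>x. f x *\<^sub>R F x)"
proof -
  obtain M where "\<And>x. norm (f x) \<le> M"
    using bounded_if_support_bounded[of f R, OF f] R by blast
  then show ?thesis
    using integrable_cutoff[OF F continuous_borel_lebesgue[OF f], of M R] R by simp
qed

section \<open>Convolution with test functions\<close>

definition conv :: "('a::euclidean_space \<Rightarrow> real) \<Rightarrow> ('a \<Rightarrow> 'b::euclidean_space) \<Rightarrow> 'a \<Rightarrow> 'b" where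
  "conv \<rho> f x = (LINT y|lebesgue. \<rho> (x - y) *\<^sub>R f y)"

lemma integrable_conv:
  assumes "test_function \<rho>" "Lp_loc 1 F"
  shows "integrable lebesgue (\<lambda>y. \<rho> (x - y) *\<^sub>R F y)"
proof -
  obtain R where R: "smooth \<rho>" "0 < R" "\<And>x. R < norm x \<Longrightarrow> \<rho> x = 0"
    using test_functionE[OF assms(1)] by metis
  have "\<rho> (x - y) = 0" if "R + norm x < norm y" for y
    using that norm_triangle_ineq2[of y x] by (intro R(3)) (simp add: norm_minus_commute)
  moreover have "continuous_on UNIV (\<lambda>y. \<rho> (x - y))"
    by (rule continuous_on_compose2[OF smooth_continuous[OF R(1), of UNIV]]) (auto intro: continuous_intros)
  ultimately show ?thesis
    using integrable_cutoff_continuous[OF assms(2), of "\<lambda>y. \<rho> (x - y)" "R + norm x"] by blast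
qed

lemma test_function_gradient_inner:
  assumes "test_function \<rho>" "b \<in> Basis"
  shows "test_function (\<lambda>x. gradient \<rho> x \<bullet> b)"
proof -
  obtain R where R: "smooth \<rho>" "\<And>x. R < norm x \<Longrightarrow> \<rho> x = 0"
    using test_functionE[OF assms(1)] by metis
  have "gradient \<rho> x = 0" if "R < norm x" for x
    using gradient_zero_outside[of R \<rho> x] R(2) that by blast
  then show ?thesis
    using assms(2) R(1)
    by (intro test_functionI[of _ R] smooth_gradient_inner) auto
qed

lemma integrable_conv_gradient:
  assumes \<rho>: "test_function \<rho>" and u: "Lp_loc 1 u"
  shows "integrable lebesgue (\<lambda>y. u y *\<^sub>R gradient \<rho> (x - y))"
proof -
  obtain R where R: "smooth \<rho>" "0 < R" "\<And>x. R < norm x \<Longrightarrow> \<rho> x = 0"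
    using test_functionE[OF \<rho>] by metis
  have g0: "gradient \<rho> x = 0" if "R < norm x" for x
    using gradient_zero_outside[of R \<rho> x] R(3) that by blast
  have um[measurable]: "u \<in> borel_measurable lebesgue"
    using u by (simp add: Lp_loc_def)
  obtain M where M: "\<And>x. norm (gradient \<rho> x) \<le> M"
    using bounded_if_support_bounded[of "gradient \<rho>" R, OF smooth_gradient_continuous[OF R(1)]] g0
    by blast
  have gm[measurable]: "(\<lambda>y. gradient \<rho> (x - y)) \<in> borel_measurable lebesgue"
    by (intro continuous_borel_lebesgue, rule continuous_on_compose2[OF smooth_gradient_continuous[OF R(1), of UNIV]])
       (auto intro: continuous_intros)
  have "norm (norm (gradient \<rho> (x - y))) \<le> M" for y using M by simp
  moreover have "norm (gradient \<rho> (x - y)) = 0" if "R + norm x < norm y" for y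
    using that norm_triangle_ineq2[of y x] by (simp add: norm_minus_commute g0)
  ultimately have "integrable lebesgue (\<lambda>y. norm (gradient \<rho> (x - y)) *\<^sub>R u y)"
    by (intro integrable_cutoff[OF u, where R="R + norm x"] borel_measurable_norm gm) auto
  then show ?thesis
    by (rule Bochner_Integration.integrable_bound) (auto simp: abs_mult mult.commute)
qed

text \<open>Differentiation under the integral by a direct estimate: uniform continuity of
  \<open>gradient \<rho>\<close> makes the linearization error of \<rho> at most
  \<open>norm (z - x) * e'\<close> for all \<open>y\<close> at once, and for \<open>z\<close> within
  distance 1 of \<open>x\<close> this error is supported in one fixed ball, where \<open>u\<close>
  is integrable.\<close>

lemma GDERIV_conv:
  assumes \<rho>: "test_function \<rho>" and u: "Lp_loc 1 u"
  shows "GDERIV (conv \<rho> u) x :> (LINT y|lebesgue. u y *\<^sub>R gradient \<rho> (x - y))"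
proof -
  obtain R where R: "smooth \<rho>" "0 < R" "\<And>x. R < norm x \<Longrightarrow> \<rho> x = 0"
    using test_functionE[OF \<rho>] by metis
  have g0: "gradient \<rho> x = 0" if "R < norm x" for x
    using gradient_zero_outside[of R \<rho> x] R(3) that by blast
  have um[measurable]: "u \<in> borel_measurable lebesgue"
    using u by (simp add: Lp_loc_def)
  have uc: "uniformly_continuous_on UNIV (gradient \<rho>)"
    using smooth_gradient_continuous[OF R(1)] g0 by (rule uniformly_continuous_if_support_bounded)
  note ig = integrable_conv_gradient[OF \<rho> u, of x]
  define D where "D = (LINT y|lebesgue. u y *\<^sub>R gradient \<rho> (x - y))"
  define I where "I = (LINT y|lebesgue. indicator (cball 0 (norm x + R + 1)) y *\<^sub>R \<bar>u y\<bar>)"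
  have iI: "integrable lebesgue (\<lambda>y. indicator (cball 0 (norm x + R + 1)) y *\<^sub>R \<bar>u y\<bar>)"
    using u by (auto simp: Lp_loc_def set_integrable_def)
  have I0: "0 \<le> I" unfolding I_def by (intro integral_nonneg_AE) auto
  have "\<exists>d>0. \<forall>z. norm (z - x) < d \<longrightarrow>
      norm (conv \<rho> u z - conv \<rho> u x - (z - x) \<bullet> D) \<le> e * norm (z - x)" if "0 < e" for e
  proof -
    \<comment> \<open>Chosen so that \<open>e' * I \<le> e\<close>; adding 1 covers the case
      \<open>I = 0\<close>.\<close>
    define e' where "e' = e / (I + 1)"
    have e': "0 < e'" using that I0 by (simp add: e'_def)
    obtain d where d: "0 < d" "\<And>y z. norm (z - y) < d \<Longrightarrow> norm (gradient \<rho> z - gradient \<rho> y) \<le> e'"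
    proof -
      obtain d where "0 < d" "\<forall>y\<in>UNIV. \<forall>z\<in>UNIV. dist z y < d \<longrightarrow> dist (gradient \<rho> z) (gradient \<rho> y) < e'"
        using uc e' unfolding uniformly_continuous_on_def by blast
      then show ?thesis
        by (intro that[of d]) (auto simp: dist_norm intro: less_imp_le)
    qed
    show ?thesis
    proof (intro exI[of _ "min d 1"] conjI allI impI)
      fix z assume z: "norm (z - x) < min d 1"
      have lin: "\<bar>\<rho> (z - y) - \<rho> (x - y) - (z - x) \<bullet> gradient \<rho> (x - y)\<bar> \<le> norm (z - x) * e'" for y
      proof -
        \<comment> \<open>The mean value inequality on the segment from \<open>x - y\<close> to
          \<open>z - y\<close>, along which the gradient stays within \<open>e'\<close> of its value
          at \<open>x - y\<close>.\<close>
        have "norm (\<rho> (z - y) - \<rho> (x - y) - (z - y - (x - y)) \<bullet> gradient \<rho> (x - y))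
            \<le> norm (z - y - (x - y)) * e'"
        proof (rule differentiable_bound_linearization[where f'="\<lambda>w h. h \<bullet> gradient \<rho> w"
              and S="(\<lambda>t. x - y + t *\<^sub>R (z - x)) ` {0..1}"])
          show "(\<rho> has_derivative (\<lambda>h. h \<bullet> gradient \<rho> w)) (at w within A)" for w A
            using smooth_GDERIV[OF R(1)] by (simp add: gderiv_def has_derivative_at_withinI)
          fix w assume "w \<in> (\<lambda>t. x - y + t *\<^sub>R (z - x)) ` {0..1::real}"
          then obtain t :: real where t: "t \<in> {0..1}" and w: "w = x - y + t *\<^sub>R (z - x)"
            by blast
          have "norm (t *\<^sub>R (z - x)) \<le> norm (z - x)"
            using t by (simp add: mult_left_le_one_le)
          then have "norm (gradient \<rho> w - gradient \<rho> (x - y)) \<le> e'"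
            using z unfolding w by (intro d(2)) simp
          then have "norm (h \<bullet> gradient \<rho> w - h \<bullet> gradient \<rho> (x - y)) \<le> norm h * e'" for h
            unfolding inner_diff_right[symmetric]
            using order_trans[OF Cauchy_Schwarz_ineq2 mult_left_mono[OF _ norm_ge_zero]] by simp
          then show "onorm ((\<lambda>h. h \<bullet> gradient \<rho> w) - (\<lambda>h. h \<bullet> gradient \<rho> (x - y))) \<le> e'"
            by (intro onorm_le) (simp add: mult.commute)
        next
          show "x - y \<in> (\<lambda>t. x - y + t *\<^sub>R (z - x)) ` {0..1::real}"
            by (rule image_eqI[of _ _ 0]) auto
        qed auto
        then show ?thesis by simp
      qed
      have zero: "\<rho> (z - y) - \<rho> (x - y) - (z - x) \<bullet> gradient \<rho> (x - y) = 0"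
        if "norm x + R + 1 < norm y" for y
      proof -
        have "R < norm (x - y)" "R < norm (z - y)"
          using that z norm_triangle_ineq2[of y x] norm_triangle_ineq2[of "y - x" "z - x"]
          by (auto simp: norm_minus_commute)
        then show ?thesis using R(3) g0 by simp
      qed
      note iz = integrable_conv[OF \<rho> u, of z] and ix = integrable_conv[OF \<rho> u, of x]
      have "conv \<rho> u z - conv \<rho> u x - (z - x) \<bullet> D = (LINT y|lebesgue.
          \<rho> (z - y) *\<^sub>R u y - \<rho> (x - y) *\<^sub>R u y - (z - x) \<bullet> (u y *\<^sub>R gradient \<rho> (x - y)))"
        unfolding conv_def D_def using iz ix ig
        by (simp only: Bochner_Integration.integral_diff Bochner_Integration.integrable_diff
            integral_inner_right integrable_inner_right)
      also have "\<dots> = (LINT y|lebesgue. (\<rho> (z - y) - \<rho> (x - y) - (z - x) \<bullet> gradient \<rho> (x - y)) * u y)"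
        by (rule Bochner_Integration.integral_cong) (simp_all add: algebra_simps)
      also have "norm \<dots> \<le> (LINT y|lebesgue. (norm (z - x) * e') * (indicator (cball 0 (norm x + R + 1)) y *\<^sub>R \<bar>u y\<bar>))"
      proof (rule Bochner_Integration.integral_norm_bound_integral)
        show "norm ((\<rho> (z - y) - \<rho> (x - y) - (z - x) \<bullet> gradient \<rho> (x - y)) * u y)
          \<le> (norm (z - x) * e') * (indicator (cball 0 (norm x + R + 1)) y *\<^sub>R \<bar>u y\<bar>)" for y
          using zero[of y] lin[of y] by (cases "norm y \<le> norm x + R + 1") (auto simp: abs_mult intro: mult_right_mono)
        have "integrable lebesgue (\<lambda>y. \<rho> (z - y) *\<^sub>R u y - \<rho> (x - y) *\<^sub>R u y - (z - x) \<bullet> (u y *\<^sub>R gradient \<rho> (x - y)))"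
          using iz ix ig
          by (intro Bochner_Integration.integrable_diff integrable_inner_right) auto
        then show "integrable lebesgue (\<lambda>y. (\<rho> (z - y) - \<rho> (x - y) - (z - x) \<bullet> gradient \<rho> (x - y)) * u y)"
          by (rule back_subst) (simp add: fun_eq_iff algebra_simps)
      qed (use iI in auto)
      also have "\<dots> = norm (z - x) * (e' * I)"
        by (simp add: I_def)
      also have "\<dots> \<le> norm (z - x) * e"
      proof (rule mult_left_mono)
        show "e' * I \<le> e"
          using that I0 by (simp add: e'_def field_simps)
      qed simp
      finally show "norm (conv \<rho> u z - conv \<rho> u x - (z - x) \<bullet> D) \<le> e * norm (z - x)"
        by (simp only: mult.commute)
    qed (use d in auto)
  qed
  then show ?thesis
    unfolding gderiv_def D_def[symmetric]
    by (subst has_derivative_at_alt) (auto intro: bounded_linear_inner_left)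
qed

text \<open>Each component of the derivative is the convolution of \<open>u\<close> with a component
  of \<open>gradient \<rho>\<close>, again a test function; hence the induction generalises over
  \<rho>.\<close>

lemma smooth_conv:
  assumes "test_function \<rho>" "Lp_loc 1 u"
  shows "smooth (conv \<rho> u)"
proof
  fix k show "Ck_on k (conv \<rho> u) UNIV"
    using assms(1)
  proof (induction k arbitrary: \<rho>)
    case 0
    then show ?case
      using GDERIV_differentiable[OF GDERIV_conv[OF 0 assms(2)]]
      by (auto intro: continuous_at_imp_continuous_on differentiable_imp_continuous_within)
  next
    case (Suc k)
    show ?case
    proof (rule Ck_on_SucI[OF GDERIV_conv[OF Suc.prems assms(2)]])
      fix b :: 'a assume b: "b \<in> Basis"
      have "(LINT y|lebesgue. u y *\<^sub>R gradient \<rho> (x - y)) \<bullet> b = conv (\<lambda>z. gradient \<rho> z \<bullet> b) u x" for x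
        unfolding conv_def using integrable_conv_gradient[OF Suc.prems assms(2)]
        by (subst integral_inner_left[symmetric]) (auto simp: mult.commute)
      then show "Ck_on k (\<lambda>x. (LINT y|lebesgue. u y *\<^sub>R gradient \<rho> (x - y)) \<bullet> b) UNIV"
        using Suc.IH[OF test_function_gradient_inner[OF Suc.prems b]] by simp
    qed
  qed
qed

lemma conv_inner:
  assumes "test_function \<rho>" "Lp_loc 1 F"
  shows "conv \<rho> F x \<bullet> b = conv \<rho> (\<lambda>y. F y \<bullet> b) x"
  unfolding conv_def using integrable_conv[OF assms, of x]
  by (subst integral_inner_left[symmetric]) auto

lemma Lp_loc_inner:
  assumes F: "Lp_loc 1 F"
  shows "Lp_loc 1 (\<lambda>y. F y \<bullet> b)"
  unfolding Lp_loc_def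
proof (intro conjI allI impI)
  have [measurable]: "F \<in> borel_measurable lebesgue"
    using F by (simp add: Lp_loc_def)
  then show "(\<lambda>y. F y \<bullet> b) \<in> borel_measurable lebesgue"
    by measurable
  fix K :: "'a set" assume K: "compact K"
  then have [measurable]: "K \<in> sets lebesgue"
    by (simp add: compact_imp_closed)
  have "integrable lebesgue (\<lambda>x. (indicator K x *\<^sub>R (norm (F x) powr 1)) * norm b)"
    using F K by (auto simp: Lp_loc_def set_integrable_def)
  then show "set_integrable lebesgue K (\<lambda>x. norm (F x \<bullet> b) powr 1)"
    unfolding set_integrable_def
    by (rule Bochner_Integration.integrable_bound)
       (auto split: split_indicator simp: Cauchy_Schwarz_ineq2)
qed

lemma continuous_on_conv:
  assumes "test_function \<rho>" "Lp_loc 1 F"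
  shows "continuous_on A (conv \<rho> F)"
  using smooth_continuous[OF smooth_conv[OF assms(1) Lp_loc_inner[OF assms(2)]]]
  by (subst continuous_on_componentwise) (simp add: conv_inner[OF assms])

text \<open>The definition of the weak gradient is applied to the reflected test function
  \<open>\<lambda>y. \<rho> (x - y)\<close>; the sign from the reflection cancels the one from
  integration by parts.\<close>

lemma gradient_conv:
  assumes u: "has_weak_gradient u G" and \<rho>: "test_function \<rho>"
  shows "gradient (conv \<rho> u) x = conv \<rho> G x"
proof (rule gradient_eqI)
  obtain R where R: "smooth \<rho>" "\<And>x. R < norm x \<Longrightarrow> \<rho> x = 0"
    using test_functionE[OF \<rho>] by metis
  define \<phi> where "\<phi> y = \<rho> ((-1) *\<^sub>R y + x)" for y
  have \<phi>: "\<phi> = (\<lambda>y. \<rho> (x - y))"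
    by (simp add: \<phi>_def fun_eq_iff)
  have g: "gradient \<phi> y = - gradient \<rho> (x - y)" for y
    using GDERIV_affine[OF smooth_GDERIV[OF R(1)], where c="-1" and d=x and x=y]
    by (intro gradient_eqI) (simp add: \<phi>)
  have "test_function \<phi>"
  proof (rule test_functionI)
    show "smooth \<phi>"
      unfolding \<phi>_def using Ck_on_affine R(1) by blast
    show "\<phi> y = 0" if "R + norm x < norm y" for y
      using that norm_triangle_ineq2[of y x] unfolding \<phi> by (intro R(2)) (simp add: norm_minus_commute)
  qed
  then have "(LINT y|lebesgue. u y *\<^sub>R gradient \<phi> y) = - (LINT y|lebesgue. \<phi> y *\<^sub>R G y)"
    using u by (simp add: has_weak_gradient_def)
  then have "(LINT y|lebesgue. u y *\<^sub>R gradient \<rho> (x - y)) = conv \<rho> G x"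
    unfolding g by (simp add: conv_def \<phi>)
  then show "GDERIV (conv \<rho> u) x :> conv \<rho> G x"
    using GDERIV_conv[OF \<rho>, of u x] u by (simp add: has_weak_gradient_def)
qed

section \<open>Mollifiers\<close>

lemma nn_integral_lborel_reflect:
  fixes f :: "'a::euclidean_space \<Rightarrow> ennreal"
  assumes [measurable]: "f \<in> borel_measurable borel"
  shows "(\<integral>\<^sup>+y. f (x - y) \<partial>lborel) = (\<integral>\<^sup>+y. f y \<partial>lborel)"
proof -
  have "(\<integral>\<^sup>+y. f y \<partial>lborel) = (\<integral>\<^sup>+y. f (x + (-1) *\<^sub>R y) \<partial>lborel)"
    by (subst lborel_affine[of "-1" x]) (simp_all add: nn_integral_density nn_integral_distr)
  then show ?thesis by simp
qed

lemma nn_integral_lborel_translate: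
  fixes f :: "'a::euclidean_space \<Rightarrow> ennreal"
  assumes [measurable]: "f \<in> borel_measurable borel"
  shows "(\<integral>\<^sup>+x. f (x - y) \<partial>lborel) = (\<integral>\<^sup>+x. f x \<partial>lborel)"
proof -
  have "(\<integral>\<^sup>+x. f x \<partial>lborel) = (\<integral>\<^sup>+x. f (- y + 1 *\<^sub>R x) \<partial>lborel)"
    by (subst lborel_affine[of 1 "- y"]) (simp_all add: nn_integral_density nn_integral_distr)
  then show ?thesis by simp
qed

lemma continuous_AE_zero:
  fixes f :: "'a::euclidean_space \<Rightarrow> real"
  assumes "continuous_on UNIV f" and "AE x in lebesgue. f x = 0"
  shows "f x = 0"
proof (rule ccontr)
  assume "f x \<noteq> 0"
  have "open {x. f x \<noteq> 0}"
    by (intro open_Collect_neq assms continuous_intros)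
  moreover have "negligible {x. f x \<noteq> 0}"
    using assms(2) negligible_subset unfolding eventually_ae_filter_negligible by auto
  ultimately show False
    using \<open>f x \<noteq> 0\<close> open_not_negligible by blast
qed

lemma integrable_continuous_support:
  assumes "continuous_on UNIV f" and "\<And>x. R < norm x \<Longrightarrow> f x = (0::real)"
  shows "integrable lebesgue f"
  using integrable_cutoff_continuous[of "\<lambda>_. 1::real" f R] assms
  by (simp add: Lp_loc_continuous)

lemma integral_pos_continuous:
  assumes f: "continuous_on UNIV f" and R: "\<And>x. R < norm x \<Longrightarrow> f x = (0::real)"
    and "\<And>x. 0 \<le> f x" and "0 < f a"
  shows "0 < (LINT x|lebesgue. f x)"
proof -
  have "integrable lebesgue f"
    by (rule integrable_continuous_support[OF f R])
  moreover have "AE x in lebesgue. 0 \<le> f x"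
    using assms(3) by simp
  ultimately have "(LINT x|lebesgue. f x) = 0 \<longleftrightarrow> (AE x in lebesgue. f x = 0)"
    by (rule integral_nonneg_eq_0_iff_AE)
  then have "(LINT x|lebesgue. f x) \<noteq> 0"
    using continuous_AE_zero[OF f, of a] assms(4) by linarith
  moreover have "0 \<le> (LINT x|lebesgue. f x)"
    using assms(3) by (intro integral_nonneg_AE) auto
  ultimately show ?thesis
    using assms(4) by linarith
qed

lemma smooth_inner_self: "smooth (\<lambda>x::'a::euclidean_space. x \<bullet> x)"
proof
  fix k
  have "Ck_on k (\<lambda>x::'a. \<Sum>b\<in>Basis. (x \<bullet> b) * (x \<bullet> b)) UNIV"
    by (intro Ck_on_sum Ck_on_mult Ck_on_inner)
  then show "Ck_on k (\<lambda>x::'a. x \<bullet> x) UNIV"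
    by (simp add: euclidean_inner[symmetric])
qed

lemma smooth_radial_bump: "smooth (\<lambda>x::'a::euclidean_space. bump (r - x \<bullet> x))"
proof (rule smooth_bump, intro allI)
  fix k
  have "Ck_on k (\<lambda>x::'a. r + (-1) * (x \<bullet> x)) UNIV"
    using smooth_inner_self by (intro Ck_on_add Ck_on_mult Ck_on_const) auto
  then show "Ck_on k (\<lambda>x::'a. r - x \<bullet> x) UNIV" by simp
qed

text \<open>The radius is a parameter instead of the scale of one fixed kernel: a separate kernel
  exists for every positive radius, and the limits below only need the radii to tend to 0.\<close>

definition mollifier :: "('a::euclidean_space \<Rightarrow> real) \<Rightarrow> real \<Rightarrow> bool" where
  "mollifier \<rho> r \<longleftrightarrow> smooth \<rho> \<and> (\<forall>x. 0 \<le> \<rho> x) \<and> (\<forall>x. r \<le> norm x \<longrightarrow> \<rho> x = 0) \<and>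
     (LINT x|lebesgue. \<rho> x) = 1"

lemma mollifier_exists:
  assumes "0 < r"
  shows "\<exists>\<rho> :: 'a::euclidean_space \<Rightarrow> real. mollifier \<rho> r"
proof -
  define f :: "'a \<Rightarrow> real" where "f x = bump (r\<^sup>2 - x \<bullet> x)" for x
  define Z where "Z = (LINT x|lebesgue. f x)"
  have f: "smooth f"
    unfolding f_def by (rule smooth_radial_bump)
  have f0: "f x = 0" if "r \<le> norm x" for x
    using that assms by (simp add: f_def dot_square_norm power_mono)
  have "0 < Z"
    unfolding Z_def using assms f0
    by (intro integral_pos_continuous[where R=r and a=0] smooth_continuous f) (auto simp: f_def)
  have "smooth (\<lambda>x. (1 / Z) * f x)"
    using f Ck_on_mult[OF Ck_on_const] by blast
  then have "mollifier (\<lambda>x. (1 / Z) * f x) r"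
    unfolding mollifier_def using \<open>0 < Z\<close> f0 by (auto simp: Z_def[symmetric]) (simp add: f_def)
  then show ?thesis by blast
qed

lemma mollifier_test_function: "mollifier \<rho> r \<Longrightarrow> test_function \<rho>"
  by (rule test_functionI[of _ r]) (auto simp: mollifier_def)

lemma mollifier_nn_integral:
  assumes "mollifier \<rho> r"
  shows "(\<integral>\<^sup>+y. ennreal (\<rho> y) \<partial>lborel) = 1"
proof -
  have "integrable lebesgue \<rho>"
    using assms smooth_continuous by (intro integrable_continuous_support[of _ r]) (auto simp: mollifier_def)
  then have "(\<integral>\<^sup>+y. ennreal (\<rho> y) \<partial>lebesgue) = 1"
    using assms by (subst nn_integral_eq_integral) (auto simp: mollifier_def)
  then show ?thesis by (simp add: nn_integral_completion)
qed

lemma mollifier_borel: "mollifier \<rho> r \<Longrightarrow> \<rho> \<in> borel_measurable borel"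
  using smooth_continuous by (intro borel_measurable_continuous_onI) (auto simp: mollifier_def)

lemma mollifier_reflect:
  assumes "mollifier \<rho> r"
  shows "integrable lebesgue (\<lambda>y. \<rho> (x - y))" and "(LINT y|lebesgue. \<rho> (x - y)) = 1"
proof -
  show i: "integrable lebesgue (\<lambda>y. \<rho> (x - y))"
    using integrable_conv[OF mollifier_test_function[OF assms], of "\<lambda>_. 1::real" x]
    by (simp add: Lp_loc_continuous)
  have "(\<integral>\<^sup>+y. ennreal (\<rho> (x - y)) \<partial>lebesgue) = 1"
    using mollifier_nn_integral[OF assms] mollifier_borel[OF assms]
      nn_integral_lborel_reflect[of "\<lambda>y. ennreal (\<rho> y)" x]
    by (simp add: nn_integral_completion)
  then show "(LINT y|lebesgue. \<rho> (x - y)) = 1"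
    using assms by (subst integral_eq_nn_integral) (use i in \<open>auto simp: mollifier_def\<close>)
qed

text \<open>\<open>conv \<rho> F x\<close> is an average of the values of \<open>F\<close> within
  distance \<open>r\<close> of \<open>x\<close>, with total weight 1.\<close>

lemma mollifier_conv_close:
  assumes \<rho>: "mollifier \<rho> r" and F: "Lp_loc 1 F"
    and c: "\<And>y. norm (y - x) < r \<Longrightarrow> norm (F y - c) \<le> e"
  shows "norm (conv \<rho> F x - c) \<le> e"
proof -
  note i = integrable_conv[OF mollifier_test_function[OF \<rho>] F, of x]
    and i1 = mollifier_reflect(1)[OF \<rho>, of x]
  have "conv \<rho> F x - c = conv \<rho> F x - (LINT y|lebesgue. \<rho> (x - y) *\<^sub>R c)"
    using i1 by (simp add: mollifier_reflect(2)[OF \<rho>])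
  also have "\<dots> = (LINT y|lebesgue. \<rho> (x - y) *\<^sub>R F y - \<rho> (x - y) *\<^sub>R c)"
    unfolding conv_def using i i1 by (subst Bochner_Integration.integral_diff) auto
  also have "norm \<dots> \<le> (LINT y|lebesgue. \<rho> (x - y) * e)"
  proof (rule Bochner_Integration.integral_norm_bound_integral)
    show "norm (\<rho> (x - y) *\<^sub>R F y - \<rho> (x - y) *\<^sub>R c) \<le> \<rho> (x - y) * e" for y
    proof (cases "norm (y - x) < r")
      case True
      then show ?thesis
        using c[OF True] \<rho> by (simp add: mollifier_def scaleR_diff_right[symmetric] mult_left_mono)
    next
      case False
      then have "\<rho> (x - y) = 0"
        using \<rho> by (simp add: mollifier_def norm_minus_commute)
      then show ?thesis by simp
    qed
  qed (use i i1 in auto)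
  also have "\<dots> = e"
    by (simp add: mollifier_reflect(2)[OF \<rho>])
  finally show ?thesis .
qed

lemma mollifier_conv_ge:
  fixes F :: "'a::euclidean_space \<Rightarrow> real"
  assumes \<rho>: "mollifier \<rho> r" and F: "Lp_loc 1 F"
    and c: "\<And>y. norm (y - x) < r \<Longrightarrow> m \<le> F y"
  shows "m \<le> conv \<rho> F x"
proof -
  note i = integrable_conv[OF mollifier_test_function[OF \<rho>] F, of x]
    and i1 = mollifier_reflect(1)[OF \<rho>, of x]
  have "m = (LINT y|lebesgue. \<rho> (x - y) * m)"
    by (simp add: mollifier_reflect(2)[OF \<rho>])
  also have "\<dots> \<le> conv \<rho> F x"
    unfolding conv_def
  proof (rule integral_mono)
    show "\<rho> (x - y) * m \<le> \<rho> (x - y) *\<^sub>R F y" for y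
      using c[of y] \<rho> by (cases "norm (y - x) < r") (auto simp: mollifier_def mult_left_mono norm_minus_commute)
  qed (use i i1 in auto)
  finally show ?thesis .
qed

text \<open>The tangent line of a convex power, with the endpoint 0 included for the Jensen
  argument. At \<open>s = 0\<close> the slope term vanishes even for \<open>p = 1\<close>, because
  \<open>0 powr 0 = 0\<close>.\<close>

lemma powr_tangent:
  fixes s t p :: real
  assumes "0 \<le> s" "0 \<le> t" "1 \<le> p"
  shows "s powr p + p * s powr (p - 1) * (t - s) \<le> t powr p"
proof (cases "s = 0 \<or> t = 0")
  case True
  show ?thesis
  proof (cases "s = 0")
    case False
    then have "s powr (p - 1) * s = s powr p"
      using assms by (simp add: powr_diff)
    then show ?thesis
      using True False assms mult_right_mono[OF assms(3), of "s powr p"] by (simp add: algebra_simps)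
  qed auto
next
  case False
  have "t powr p - s powr p \<ge> (p * s powr (p - 1)) * (t - s)"
    using False assms
    by (intro convex_on_imp_above_tangent[of "{0<..}"] powr_convex)
       (auto intro!: derivative_eq_intros simp: interior_open)
  then show ?thesis by simp
qed

lemma Lp_loc_norm_powr:
  assumes "Lp_loc p F"
  shows "Lp_loc 1 (\<lambda>y. norm (F y) powr p)"
proof -
  have [measurable]: "F \<in> borel_measurable lebesgue"
    using assms by (simp add: Lp_loc_def)
  have "(\<lambda>y. norm (F y) powr p) \<in> borel_measurable lebesgue"
    by measurable
  then show ?thesis
    using assms by (simp add: Lp_loc_def)
qed

text \<open>Jensen's inequality for the probability density
  \<open>\<lambda>y. \<rho> (x - y)\<close>: the tangent line inequality at the mean
  \<open>s\<close> of \<open>norm (F y)\<close> is integrated, and its linear term has integral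
  zero.\<close>

lemma mollifier_jensen:
  assumes \<rho>: "mollifier \<rho> r" and F: "Lp_loc p F" and p: "1 \<le> p"
  shows "norm (conv \<rho> F x) powr p \<le> conv \<rho> (\<lambda>y. norm (F y) powr p) x"
proof -
  have F1: "Lp_loc 1 F" and Fn: "Lp_loc 1 (\<lambda>y. norm (F y))"
    using Lp_loc_mono[OF F p] by (auto simp: Lp_loc_def)
  note t = mollifier_test_function[OF \<rho>]
  note i = integrable_conv[OF t F1, of x] and i1 = mollifier_reflect(1)[OF \<rho>, of x]
    and ip = integrable_conv[OF t Lp_loc_norm_powr[OF F], of x] and iN = integrable_conv[OF t Fn, of x]
  define s where "s = (LINT y|lebesgue. \<rho> (x - y) * norm (F y))"
  have \<rho>0: "0 \<le> \<rho> y" for y using \<rho> by (simp add: mollifier_def)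
  have s: "norm (conv \<rho> F x) \<le> s"
    unfolding conv_def s_def using i iN \<rho>0 by (intro Bochner_Integration.integral_norm_bound_integral) auto
  then have s0: "0 \<le> s" using norm_ge_zero order_trans by blast
  have "norm (conv \<rho> F x) powr p \<le> s powr p"
    using s p by (intro powr_mono2) auto
  \<comment> \<open>Each factor 1 stands for the integral of the kernel and the remaining
    \<open>s\<close> in the bracket for the integral of \<open>\<rho> (x - y) * norm (F y)\<close>,
    so that the next step can read this number as an integral.\<close>
  also have "\<dots> = s powr p * 1 + p * s powr (p - 1) * (s - s * 1)" by simp
  also have "\<dots> = (LINT y|lebesgue. s powr p * \<rho> (x - y) + p * s powr (p - 1) * (\<rho> (x - y) * norm (F y) - s * \<rho> (x - y)))"
    using i1 iN by (simp add: mollifier_reflect(2)[OF \<rho>] s_def[symmetric])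
  also have "\<dots> \<le> conv \<rho> (\<lambda>y. norm (F y) powr p) x"
    unfolding conv_def
  proof (rule integral_mono)
    show "s powr p * \<rho> (x - y) + p * s powr (p - 1) * (\<rho> (x - y) * norm (F y) - s * \<rho> (x - y))
        \<le> \<rho> (x - y) *\<^sub>R norm (F y) powr p" for y
      using mult_left_mono[OF powr_tangent[OF s0 norm_ge_zero p, of "F y"] \<rho>0[of "x - y"]]
      by (simp add: algebra_simps)
  qed (use i1 iN ip in auto)
  finally show ?thesis .
qed

text \<open>Tonelli's theorem: a kernel of mass 1 and radius \<open>r\<close> preserves the mass of
  \<open>f\<close> and moves it by at most \<open>r\<close>, whence the enlarged ball.\<close>

lemma integral_conv_le:
  fixes f :: "'a::euclidean_space \<Rightarrow> real"
  assumes \<rho>: "mollifier \<rho> r" and f: "Lp_loc 1 f" and f0: "\<And>x. 0 \<le> f x"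
  shows "(LINT x|lebesgue. indicator (cball 0 R) x * conv \<rho> f x)
     \<le> (LINT x|lebesgue. indicator (cball 0 (R + r)) x * f x)"
proof -
  have [measurable]: "\<rho> \<in> borel_measurable borel"
    by (rule mollifier_borel[OF \<rho>])
  have \<rho>0: "0 \<le> \<rho> y" for y using \<rho> by (simp add: mollifier_def)
  have fm: "f \<in> borel_measurable lebesgue"
    using f by (simp add: Lp_loc_def)
  \<comment> \<open>Measurability on the product space calls for Borel functions, while
    \<open>f\<close> is only Lebesgue measurable; an a.e. equal Borel function takes its
    place.\<close>
  then obtain g :: "'a \<Rightarrow> ennreal" where [measurable]: "g \<in> borel_measurable borel"
    and g: "AE y in lborel. ennreal (f y) = g y"
    using completion_ex_borel_measurable[of "\<lambda>y. ennreal (f y)" lborel] by auto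
  have ind_f: "integrable lebesgue (\<lambda>x. indicator (cball 0 S) x * f x)" for S
    using f f0 by (auto simp: Lp_loc_def set_integrable_def)
  have cont: "continuous_on UNIV (conv \<rho> f)"
    by (rule continuous_on_conv[OF mollifier_test_function[OF \<rho>] f])
  have conv0: "0 \<le> conv \<rho> f x" for x
    using mollifier_conv_ge[OF \<rho> f, of x 0] f0 by blast
  have ind_c: "integrable lebesgue (\<lambda>x. indicator (cball 0 R) x * conv \<rho> f x)"
    using Lp_loc_continuous[OF cont, of 1] conv0 by (auto simp: Lp_loc_def set_integrable_def)
  have "ennreal (conv \<rho> f x) = (\<integral>\<^sup>+y. ennreal (\<rho> (x - y)) * g y \<partial>lborel)" for x
  proof -
    have "ennreal (conv \<rho> f x) = (\<integral>\<^sup>+y. ennreal (\<rho> (x - y) * f y) \<partial>lebesgue)"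
      unfolding conv_def using integrable_conv[OF mollifier_test_function[OF \<rho>] f, of x] \<rho>0 f0
      by (subst nn_integral_eq_integral) auto
    also have "\<dots> = (\<integral>\<^sup>+y. ennreal (\<rho> (x - y)) * g y \<partial>lborel)"
      unfolding nn_integral_completion using g
      by (intro nn_integral_cong_AE) (auto simp: ennreal_mult[OF \<rho>0 f0])
    finally show ?thesis .
  qed
  then have "(\<integral>\<^sup>+x. indicator (cball 0 R) x * ennreal (conv \<rho> f x) \<partial>lborel)
      = (\<integral>\<^sup>+x. \<integral>\<^sup>+y. indicator (cball 0 R) x * (ennreal (\<rho> (x - y)) * g y) \<partial>lborel \<partial>lborel)"
    by (simp add: nn_integral_cmult)
  also have "\<dots> = (\<integral>\<^sup>+y. \<integral>\<^sup>+x. indicator (cball 0 R) x * (ennreal (\<rho> (x - y)) * g y) \<partial>lborel \<partial>lborel)"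
  proof (rule lborel_pair.Fubini'[symmetric])
    have [measurable]: "Measurable.pred (borel \<Otimes>\<^sub>M borel) (\<lambda>x::'a \<times> 'a. fst x \<in> cball 0 R)"
      unfolding mem_cball by measurable
    have "(\<lambda>x. indicator (cball 0 R) (fst x) * (ennreal (\<rho> (fst x - snd x)) * g (snd x)))
        \<in> borel_measurable (borel \<Otimes>\<^sub>M borel)"
      by measurable
    then show "(\<lambda>(x, y). indicator (cball 0 R) x * (ennreal (\<rho> (x - y)) * g y))
        \<in> borel_measurable (lborel \<Otimes>\<^sub>M lborel)"
      by (simp add: case_prod_beta)
  qed
  also have "\<dots> \<le> (\<integral>\<^sup>+y. indicator (cball 0 (R + r)) y * g y \<partial>lborel)"
  proof (rule nn_integral_mono)
    fix y
    show "(\<integral>\<^sup>+x. indicator (cball 0 R) x * (ennreal (\<rho> (x - y)) * g y) \<partial>lborel)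
        \<le> indicator (cball 0 (R + r)) y * g y"
    proof (cases "norm y \<le> R + r")
      case True
      have "(\<integral>\<^sup>+x. indicator (cball 0 R) x * (ennreal (\<rho> (x - y)) * g y) \<partial>lborel)
          \<le> (\<integral>\<^sup>+x. ennreal (\<rho> (x - y)) * g y \<partial>lborel)"
        by (intro nn_integral_mono) (auto split: split_indicator)
      also have "\<dots> = g y"
        using nn_integral_lborel_translate[of "\<lambda>x. ennreal (\<rho> x)" y] mollifier_nn_integral[OF \<rho>]
        by (simp add: nn_integral_multc)
      finally show ?thesis using True by simp
    next
      case False
      have "indicator (cball 0 R) x * (ennreal (\<rho> (x - y)) * g y) = 0" for x
      proof (cases "norm x \<le> R")
        case True
        then have "r \<le> norm (x - y)"
          using False norm_triangle_ineq2[of y x] by (simp add: norm_minus_commute)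
        then show ?thesis using \<rho> by (simp add: mollifier_def)
      qed auto
      then have "(\<integral>\<^sup>+x. indicator (cball 0 R) x * (ennreal (\<rho> (x - y)) * g y) \<partial>lborel) = 0"
        by (simp only: nn_integral_const mult_zero_left)
      then show ?thesis by simp
    qed
  qed
  also have "\<dots> = (\<integral>\<^sup>+y. ennreal (indicator (cball 0 (R + r)) y * f y) \<partial>lborel)"
    using g by (intro nn_integral_cong_AE) (auto split: split_indicator)
  also have "\<dots> = ennreal (LINT x|lebesgue. indicator (cball 0 (R + r)) x * f x)"
    using nn_integral_eq_integral[OF ind_f, of "R + r"] f0 by (simp add: nn_integral_completion)
  also have "(\<integral>\<^sup>+x. indicator (cball 0 R) x * ennreal (conv \<rho> f x) \<partial>lborel)
      = (\<integral>\<^sup>+x. ennreal (indicator (cball 0 R) x * conv \<rho> f x) \<partial>lebesgue)"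
    unfolding nn_integral_completion by (intro nn_integral_cong) (auto split: split_indicator)
  also have "\<dots> = ennreal (LINT x|lebesgue. indicator (cball 0 R) x * conv \<rho> f x)"
    using ind_c conv0 by (subst nn_integral_eq_integral) auto
  finally show ?thesis
    using f0 by (subst (asm) ennreal_le_iff) (auto intro!: integral_nonneg_AE)
qed

section \<open>Strong convergence of mollifications\<close>

lemma powr_add_le:
  fixes s t p :: real
  assumes "0 \<le> s" "0 \<le> t" "0 \<le> p"
  shows "(s + t) powr p \<le> 2 powr p * (s powr p + t powr p)"
proof -
  have "(s + t) powr p \<le> (2 * max s t) powr p"
    using assms by (intro powr_mono2) auto
  also have "\<dots> = 2 powr p * max s t powr p"
    using assms by (simp add: powr_mult)
  also have "max s t powr p \<le> s powr p + t powr p"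
    by (simp add: max_def)
  finally show ?thesis by simp
qed

lemma Lp_loc_integrable:
  assumes "Lp_loc p F"
  shows "integrable lebesgue (\<lambda>x. indicator (cball 0 R) x * norm (F x) powr p)"
  using assms by (simp add: Lp_loc_def set_integrable_def)

lemma integrable_indicator_cball: "integrable lebesgue (\<lambda>x. indicator (cball 0 R) x * (c::real))"
  using emeasure_compact_finite[of "cball 0 R"] by (intro integrable_mult_left integrable_real_indicator) auto

lemma Lp_loc_measurable: "Lp_loc p F \<Longrightarrow> F \<in> borel_measurable lebesgue"
  by (simp add: Lp_loc_def)

lemma Lp_loc_diff:
  assumes F: "Lp_loc p F" and G: "Lp_loc p G" and p: "0 \<le> p"
  shows "Lp_loc p (\<lambda>x. F x - G x)"
  unfolding Lp_loc_def
proof (intro conjI allI impI)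
  note [measurable] = Lp_loc_measurable[OF F] Lp_loc_measurable[OF G]
  show "(\<lambda>x. F x - G x) \<in> borel_measurable lebesgue"
    by measurable
  fix K :: "'a set" assume K: "compact K"
  then have [measurable]: "K \<in> sets lebesgue"
    by (simp add: compact_imp_closed)
  have "integrable lebesgue (\<lambda>x. 2 powr p * (indicator K x *\<^sub>R (norm (F x) powr p) + indicator K x *\<^sub>R (norm (G x) powr p)))"
    using F G K by (intro integrable_mult_right Bochner_Integration.integrable_add)
      (auto simp: Lp_loc_def set_integrable_def)
  moreover have "norm (F x - G x) powr p \<le> 2 powr p * (norm (F x) powr p + norm (G x) powr p)" for x
    by (rule order_trans[OF powr_mono2[OF p _ norm_triangle_ineq4] powr_add_le]) (use p in auto)
  ultimately show "set_integrable lebesgue K (\<lambda>x. norm (F x - G x) powr p)"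
    unfolding set_integrable_def
    by (elim Bochner_Integration.integrable_bound) (auto split: split_indicator)
qed

lemma Lp_loc_dominated:
  assumes F: "Lp_loc p F" and [measurable]: "f \<in> borel_measurable lebesgue"
    and le: "\<And>x. norm (f x) \<le> norm (F x)" and p: "0 \<le> p"
  shows "Lp_loc p f"
  unfolding Lp_loc_def
proof (intro conjI allI impI assms)
  fix K :: "'a set" assume K: "compact K"
  then have [measurable]: "K \<in> sets lebesgue"
    by (simp add: compact_imp_closed)
  have "integrable lebesgue (\<lambda>x. indicator K x *\<^sub>R (norm (F x) powr p))"
    using F K by (simp add: Lp_loc_def set_integrable_def)
  then show "set_integrable lebesgue K (\<lambda>x. norm (f x) powr p)"
    unfolding set_integrable_def
    by (rule Bochner_Integration.integrable_bound)
       (use le p in \<open>auto split: split_indicator intro!: powr_mono2\<close>)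
qed

text \<open>The scaled vector is the radial projection onto the ball of radius \<open>m\<close>,
  written with \<open>max\<close> so that continuity in \<open>v\<close> is evident.\<close>

lemma norm_truncation:
  fixes v :: "'b::real_normed_vector"
  assumes "0 < m"
  shows "norm ((m / max m (norm v)) *\<^sub>R v) \<le> m" and "norm (v - (m / max m (norm v)) *\<^sub>R v) \<le> norm v"
proof -
  show "norm ((m / max m (norm v)) *\<^sub>R v) \<le> m"
    using assms by (auto simp: max_def field_simps)
  have "v - (m / max m (norm v)) *\<^sub>R v = (1 - m / max m (norm v)) *\<^sub>R v"
    by (simp add: scaleR_diff_left)
  moreover have "0 \<le> m / max m (norm v)" "m / max m (norm v) \<le> 1"
    using assms by auto
  then have "\<bar>1 - m / max m (norm v)\<bar> \<le> 1"
    by linarith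
  ultimately show "norm (v - (m / max m (norm v)) *\<^sub>R v) \<le> norm v"
    using mult_right_mono[of "\<bar>1 - m / max m (norm v)\<bar>" 1 "norm v"] by simp
qed

lemma powr_tendsto_zero:
  assumes "(f \<longlongrightarrow> (0::real)) F" "0 < p" "\<And>x. 0 \<le> f x"
  shows "((\<lambda>x. f x powr p) \<longlongrightarrow> 0) F"
  using tendsto_powr'[OF assms(1) tendsto_const, of p] assms(2,3) by simp

text \<open>Two approximations by dominated convergence: first \<open>F\<close> is truncated at a
  height \<open>m\<close>, then the bounded truncation is approximated by truncations of continuous
  functions that converge to \<open>F\<close> a.e.\<close>

lemma Lp_dense_continuous:
  fixes F :: "'a::euclidean_space \<Rightarrow> 'b::euclidean_space"
  assumes F: "Lp_loc p F" and p: "1 \<le> p" and e: "0 < e"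
  shows "\<exists>g. continuous_on UNIV g \<and>
    (LINT x|lebesgue. indicator (cball 0 R) x * norm (F x - g x) powr p) < e"
proof -
  note Fm[measurable] = Lp_loc_measurable[OF F]
  have [measurable]: "cball 0 R \<in> sets (lebesgue :: 'a measure)"
    by simp
  define T where "T m v = (m / max m (norm v)) *\<^sub>R v" for m and v :: 'b
  have T_le: "norm (T m v) \<le> m" "norm (v - T m v) \<le> norm v" if "0 < m" for m v
    unfolding T_def using norm_truncation[OF that] by blast+
  have T_cont: "continuous_on UNIV (T m)" if "0 < m" for m
    unfolding T_def using that by (intro continuous_intros) (auto simp: max_def)
  have T_eq: "T m v = v" if "norm v \<le> m" "0 < m" for m v
    using that by (simp add: T_def max_absorb1)
  define I where "I h = (LINT x|lebesgue. indicator (cball 0 R) x * norm (h x) powr p)" for h :: "'a \<Rightarrow> 'b"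
  have Tm: "(\<lambda>x. T m (h x)) \<in> borel_measurable lebesgue"
    if "h \<in> borel_measurable lebesgue" "0 < m" for h m
    using measurable_compose[OF that(1) borel_measurable_continuous_onI[OF T_cont[OF that(2)]]] .
  have "(\<lambda>n. I (\<lambda>x. F x - T (real (Suc n)) (F x))) \<longlonglongrightarrow> (LINT x|(lebesgue::'a measure). 0)"
    unfolding I_def
  proof (rule integral_dominated_convergence)
    show "integrable lebesgue (\<lambda>x. indicator (cball 0 R) x * norm (F x) powr p)"
      by (rule Lp_loc_integrable[OF F])
    show "(\<lambda>x. indicator (cball 0 R) x * norm (F x - T (real (Suc n)) (F x)) powr p) \<in> borel_measurable lebesgue" for n
    proof -
      have [measurable]: "(\<lambda>x. T (real (Suc n)) (F x)) \<in> borel_measurable lebesgue"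
        by (rule Tm[OF Fm]) simp
      show ?thesis by measurable
    qed
    show "AE x in lebesgue. norm (indicator (cball 0 R) x * norm (F x - T (real (Suc n)) (F x)) powr p)
        \<le> indicator (cball 0 R) x * norm (F x) powr p" for n
      using T_le(2) p by (auto split: split_indicator intro!: powr_mono2)
    show "AE x in lebesgue. (\<lambda>n. indicator (cball 0 R) x * norm (F x - T (real (Suc n)) (F x)) powr p) \<longlonglongrightarrow> 0"
    proof (rule AE_I2, rule tendsto_eventually)
      fix x
      obtain N :: nat where "norm (F x) \<le> real N"
        using real_arch_simple by blast
      then show "\<forall>\<^sub>F n in sequentially. indicator (cball 0 R) x * norm (F x - T (real (Suc n)) (F x)) powr p = 0"
        using p by (intro eventually_sequentiallyI[of N]) (simp add: T_eq)
    qed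
  qed simp
  \<comment> \<open>Two errors below \<open>e'\<close> will enter through
    \<open>powr_add_le\<close>, whose factor is \<open>2 powr p\<close>.\<close>
  moreover define e' where "e' = e / (2 * 2 powr p)"
  moreover have e': "0 < e'" using e by (simp add: e'_def)
  ultimately have "\<forall>\<^sub>F n in sequentially. I (\<lambda>x. F x - T (real (Suc n)) (F x)) < e'"
    by (auto intro: order_tendstoD)
  then obtain n where n: "I (\<lambda>x. F x - T (real (Suc n)) (F x)) < e'"
    using eventually_happens'[OF sequentially_bot] by blast
  define m where "m = real (Suc n)"
  have m: "0 < m" by (simp add: m_def)
  \<comment> \<open>Supplies continuous functions converging to \<open>F\<close> off a negligible
    set. Nothing dominates them, so \<open>T m\<close> is applied to them as well, which yields the
    constant bound \<open>(2 * m) powr p\<close> on the ball.\<close>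
  have "F measurable_on UNIV"
    by (rule lebesgue_measurable_imp_measurable_on[OF Fm]) simp
  then obtain N g where N: "negligible N" and g: "\<And>n. continuous_on UNIV (g n :: 'a \<Rightarrow> 'b)"
    and lim: "\<And>x. x \<notin> N \<Longrightarrow> (\<lambda>n. g n x) \<longlonglongrightarrow> F x"
    unfolding measurable_on_def by auto
  have gm[measurable]: "g n \<in> borel_measurable lebesgue" for n
    by (rule continuous_borel_lebesgue[OF g])
  note [measurable] = Tm[OF Fm m] Tm[OF gm m]
  have "(\<lambda>n. I (\<lambda>x. T m (F x) - T m (g n x))) \<longlonglongrightarrow> (LINT x|(lebesgue::'a measure). 0)"
    unfolding I_def
  proof (rule integral_dominated_convergence)
    show "integrable lebesgue (\<lambda>x::'a. indicator (cball 0 R) x * (2 * m) powr p)"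
      by (rule integrable_indicator_cball)
    show "(\<lambda>x. indicator (cball 0 R) x * norm (T m (F x) - T m (g n x)) powr p) \<in> borel_measurable lebesgue" for n
      by measurable
    have "norm (T m (F x) - T m (g n x)) \<le> 2 * m" for x n
      using norm_triangle_ineq4[of "T m (F x)" "T m (g n x)"] T_le(1)[OF m, of "F x"] T_le(1)[OF m, of "g n x"]
      by linarith
    then show "AE x in lebesgue. norm (indicator (cball 0 R) x * norm (T m (F x) - T m (g n x)) powr p)
        \<le> indicator (cball 0 R) x * (2 * m) powr p" for n
      using p by (auto split: split_indicator intro!: powr_mono2)
    have "(\<lambda>n. indicator (cball 0 R) x * norm (T m (F x) - T m (g n x)) powr p) \<longlonglongrightarrow> 0" if "x \<notin> N" for x
    proof -
      have "(\<lambda>n. T m (g n x)) \<longlonglongrightarrow> T m (F x)"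
        using continuous_on_tendsto_compose[OF T_cont[OF m] lim[OF that]] by simp
      then have "(\<lambda>n. norm (T m (F x) - T m (g n x))) \<longlonglongrightarrow> 0"
        using tendsto_norm_zero[OF LIM_zero] by (subst norm_minus_commute)
      then show ?thesis
        using tendsto_mult_right_zero[OF powr_tendsto_zero, of _ sequentially p "indicator (cball 0 R) x"] p by simp
    qed
    then show "AE x in lebesgue. (\<lambda>n. indicator (cball 0 R) x * norm (T m (F x) - T m (g n x)) powr p) \<longlonglongrightarrow> 0"
      unfolding eventually_ae_filter_negligible using N by blast
  qed simp
  then have "\<forall>\<^sub>F n in sequentially. I (\<lambda>x. T m (F x) - T m (g n x)) < e'"
    using e' by (auto intro: order_tendstoD)
  then obtain k where k: "I (\<lambda>x. T m (F x) - T m (g k x)) < e'"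
    using eventually_happens'[OF sequentially_bot] by blast
  define h where "h x = T m (g k x)" for x
  have h: "continuous_on UNIV h"
    unfolding h_def using continuous_on_compose2[OF T_cont[OF m] g] by simp
  have TF: "Lp_loc p (\<lambda>x. T m (F x))"
  proof -
    have "Lp_loc p (\<lambda>x. F x - T m (F x))"
      using T_le(2)[OF m] p by (intro Lp_loc_dominated[OF F]) auto
    from Lp_loc_diff[OF F this] p show ?thesis by simp
  qed
  have p0: "0 \<le> p" using p by simp
  note h' = Lp_loc_continuous[OF h p0]
  have "I (\<lambda>x. F x - h x) \<le> (LINT x|lebesgue. 2 powr p *
      (indicator (cball 0 R) x * norm (F x - T m (F x)) powr p + indicator (cball 0 R) x * norm (T m (F x) - h x) powr p))"
    unfolding I_def
  proof (rule integral_mono)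
    show "indicator (cball 0 R) x * norm (F x - h x) powr p \<le> 2 powr p *
      (indicator (cball 0 R) x * norm (F x - T m (F x)) powr p + indicator (cball 0 R) x * norm (T m (F x) - h x) powr p)" for x
    proof -
      have "norm (F x - h x) powr p \<le> (norm (F x - T m (F x)) + norm (T m (F x) - h x)) powr p"
        using norm_triangle_ineq[of "F x - T m (F x)" "T m (F x) - h x"] p by (intro powr_mono2) auto
      also have "\<dots> \<le> 2 powr p * (norm (F x - T m (F x)) powr p + norm (T m (F x) - h x) powr p)"
        using p by (intro powr_add_le) auto
      finally show ?thesis by (auto split: split_indicator)
    qed
    show "integrable lebesgue (\<lambda>x. indicator (cball 0 R) x * norm (F x - h x) powr p)"
      by (intro Lp_loc_integrable Lp_loc_diff F h' p0)
    show "integrable lebesgue (\<lambda>x. 2 powr p *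
      (indicator (cball 0 R) x * norm (F x - T m (F x)) powr p + indicator (cball 0 R) x * norm (T m (F x) - h x) powr p))"
      by (intro integrable_mult_right Bochner_Integration.integrable_add Lp_loc_integrable Lp_loc_diff F TF h' p0)
  qed
  also have "\<dots> = 2 powr p * (I (\<lambda>x. F x - T m (F x)) + I (\<lambda>x. T m (F x) - h x))"
    unfolding I_def by (simp add: Lp_loc_integrable Lp_loc_diff F TF h' p0)
  also have "\<dots> < 2 powr p * (e' + e')"
    using n k by (intro mult_strict_left_mono add_strict_mono) (auto simp: m_def h_def)
  also have "\<dots> = e" by (simp add: e'_def)
  finally show ?thesis
    using h unfolding I_def by blast
qed

text \<open>The difference of \<open>F\<close> and a continuous approximation is controlled after mollification by
  Jensen's inequality and Tonelli's theorem.\<close>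

lemma conv_tendsto_Lp:
  fixes F :: "'a::euclidean_space \<Rightarrow> 'b::euclidean_space"
  assumes F: "Lp_loc p F" and p: "1 \<le> p"
    and \<rho>: "\<And>j. mollifier (\<rho> j) (r j)" and r: "r \<longlonglongrightarrow> 0"
  shows "(\<lambda>j. LINT x|lebesgue. indicator (cball 0 R) x * norm (conv (\<rho> j) F x - F x) powr p) \<longlonglongrightarrow> 0"
proof (rule LIMSEQ_I)
  fix e :: real assume e: "0 < e"
  have p0: "0 \<le> p" using p by simp
  note t = mollifier_test_function[OF \<rho>]
  note F1 = Lp_loc_mono[OF F p]
  define B where "B = (LINT x|(lebesgue::'a measure). indicator (cball 0 R) x * (1::real))"
  have B0: "0 \<le> B" unfolding B_def by (intro integral_nonneg_AE) auto
  \<comment> \<open>One use of \<open>powr_add_le\<close> splits off \<open>g\<close>, a second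
    separates \<open>F - g\<close> from its mollification.\<close>
  define c :: real where "c = 2 powr p * (2 powr p)"
  have c0: "0 < c" by (simp add: c_def)
  \<comment> \<open>The final bound consists of \<open>c * e1\<close> twice and
    \<open>c * e2 powr p * B\<close> once, each at most \<open>e / 4\<close>. The
    \<open>B + 1\<close> guards against a ball of volume zero.\<close>
  define e1 where "e1 = e / (4 * c)"
  define e2 where "e2 = (e / (4 * c * (B + 1))) powr (1 / p)"
  have e1: "0 < e1" using e c0 by (simp add: e1_def)
  have e2: "0 < e2" "e2 powr p * B \<le> e / (4 * c)"
  proof -
    have pos: "0 < e / (4 * c * (B + 1))"
      using e c0 B0 by simp
    then show "0 < e2" unfolding e2_def by (subst powr_gt_zero) linarith
    have "e2 powr p * B = e / (4 * c) * (B / (B + 1))"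
      using pos p e c0 B0 by (simp add: e2_def powr_powr abs_mult)
    also have "\<dots> \<le> e / (4 * c) * 1"
      using e c0 B0 by (intro mult_left_mono) auto
    finally show "e2 powr p * B \<le> e / (4 * c)" by simp
  qed
  obtain g where g: "continuous_on UNIV g"
    and ge: "(LINT x|lebesgue. indicator (cball 0 (R + 1)) x * norm (F x - g x) powr p) < e1"
    using Lp_dense_continuous[OF F p e1] by blast
  note gp = Lp_loc_continuous[OF g p0]
  note g1 = Lp_loc_mono[OF gp p]
  define D where "D x = F x - g x" for x
  have D: "Lp_loc p D" unfolding D_def by (rule Lp_loc_diff[OF F gp p0])
  have "uniformly_continuous_on (cball 0 (R + 1)) g"
    using g by (intro compact_uniformly_continuous) (auto intro: continuous_on_subset)
  then obtain d where d: "0 < d" "\<And>x y. norm x \<le> R + 1 \<Longrightarrow> norm y \<le> R + 1 \<Longrightarrow> norm (y - x) < d \<Longrightarrow> norm (g y - g x) < e2"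
    using e2(1) unfolding uniformly_continuous_on_def dist_norm by (metis mem_cball_0)
  have "\<forall>\<^sub>F j in sequentially. r j < min d 1"
    using r d(1) by (intro order_tendstoD) auto
  then obtain j0 where j0: "\<And>j. j \<ge> j0 \<Longrightarrow> r j < min d 1"
    unfolding eventually_sequentially by blast
  show "\<exists>j0. \<forall>j\<ge>j0. norm ((LINT x|lebesgue. indicator (cball 0 R) x * norm (conv (\<rho> j) F x - F x) powr p) - 0) < e"
  proof (intro exI[of _ j0] allI impI)
    fix j assume "j0 \<le> j"
    then have rj: "r j < d" "r j < 1" using j0[of j] by auto
    have cg: "norm (conv (\<rho> j) g x - g x) \<le> e2" if "norm x \<le> R" for x
    proof (rule mollifier_conv_close[OF \<rho> g1])
      fix y assume "norm (y - x) < r j"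
      then have "norm (y - x) < d" "norm y \<le> R + 1"
        using rj that norm_triangle_ineq[of x "y - x"] by auto
      then show "norm (g y - g x) \<le> e2"
        using d(2)[of x y] that by simp
    qed
    have split: "conv (\<rho> j) F x - F x = (conv (\<rho> j) D x - D x) + (conv (\<rho> j) g x - g x)" for x
      unfolding conv_def D_def scaleR_diff_right
      using integrable_conv[OF t F1] integrable_conv[OF t g1]
      by (subst Bochner_Integration.integral_diff) auto
    have convD: "Lp_loc p (conv (\<rho> j) D)"
      by (rule Lp_loc_continuous[OF continuous_on_conv[OF t Lp_loc_mono[OF D p]] p0])
    have convDp: "Lp_loc 1 (conv (\<rho> j) (\<lambda>y. norm (D y) powr p))"
      by (rule Lp_loc_continuous[OF continuous_on_conv[OF t Lp_loc_norm_powr[OF D]]]) simp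
    have convDp0: "0 \<le> conv (\<rho> j) (\<lambda>y. norm (D y) powr p) x" for x
      by (rule mollifier_conv_ge[OF \<rho> Lp_loc_norm_powr[OF D]]) simp
    have convF: "Lp_loc p (conv (\<rho> j) F)"
      by (rule Lp_loc_continuous[OF continuous_on_conv[OF t F1] p0])
    let ?I = "indicator (cball 0 R) :: 'a \<Rightarrow> real"
    have le: "norm (conv (\<rho> j) F x - F x) powr p
        \<le> c * (conv (\<rho> j) (\<lambda>y. norm (D y) powr p) x + norm (D x) powr p) + c * e2 powr p"
      if "norm x \<le> R" for x
    proof -
      have "norm (conv (\<rho> j) F x - F x) \<le> norm (conv (\<rho> j) D x - D x) + e2"
        unfolding split using norm_triangle_le cg[OF that] add_left_mono by (metis norm_triangle_ineq order_trans)
      then have "norm (conv (\<rho> j) F x - F x) powr p \<le> (norm (conv (\<rho> j) D x - D x) + e2) powr p"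
        using p by (intro powr_mono2) auto
      also have "\<dots> \<le> 2 powr p * (norm (conv (\<rho> j) D x - D x) powr p + e2 powr p)"
        using p e2 by (intro powr_add_le) auto
      also have "norm (conv (\<rho> j) D x - D x) powr p \<le> (norm (conv (\<rho> j) D x) + norm (D x)) powr p"
        using p by (intro powr_mono2 norm_triangle_ineq4) auto
      also have "\<dots> \<le> 2 powr p * (norm (conv (\<rho> j) D x) powr p + norm (D x) powr p)"
        using p by (intro powr_add_le) auto
      also have "norm (conv (\<rho> j) D x) powr p \<le> conv (\<rho> j) (\<lambda>y. norm (D y) powr p) x"
        by (rule mollifier_jensen[OF \<rho> D p])
      finally have "norm (conv (\<rho> j) F x - F x) powr p \<le> 2 powr p * (2 powr p *
          (conv (\<rho> j) (\<lambda>y. norm (D y) powr p) x + norm (D x) powr p) + e2 powr p)"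
        by simp
      also have "\<dots> \<le> c * (conv (\<rho> j) (\<lambda>y. norm (D y) powr p) x + norm (D x) powr p) + c * e2 powr p"
        using mult_right_mono[OF ge_one_powr_ge_zero[of 2 p], of "e2 powr p"] p unfolding c_def
        by (simp add: distrib_left mult.assoc mult_left_mono mult_right_mono)
      finally show ?thesis .
    qed
    have i1: "integrable lebesgue (\<lambda>x. ?I x * conv (\<rho> j) (\<lambda>y. norm (D y) powr p) x)"
      using Lp_loc_integrable[OF convDp, of R] convDp0 by simp
    have i2: "integrable lebesgue (\<lambda>x. indicator (cball 0 S) x * norm (D x) powr p)" for S
      by (rule Lp_loc_integrable[OF D])
    have i3: "integrable lebesgue (\<lambda>x. ?I x * 1)"
      by (rule integrable_indicator_cball)
    have "(LINT x|lebesgue. ?I x * norm (conv (\<rho> j) F x - F x) powr p)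
      \<le> (LINT x|lebesgue. c * (?I x * conv (\<rho> j) (\<lambda>y. norm (D y) powr p) x + ?I x * norm (D x) powr p)
            + (c * e2 powr p) * (?I x * 1))"
    proof (rule integral_mono)
      show "integrable lebesgue (\<lambda>x. ?I x * norm (conv (\<rho> j) F x - F x) powr p)"
        by (intro Lp_loc_integrable Lp_loc_diff convF F p0)
      show "integrable lebesgue (\<lambda>x. c * (?I x * conv (\<rho> j) (\<lambda>y. norm (D y) powr p) x + ?I x * norm (D x) powr p)
            + (c * e2 powr p) * (?I x * 1))"
        by (intro Bochner_Integration.integrable_add integrable_mult_right i1 i2 i3)
      show "?I x * norm (conv (\<rho> j) F x - F x) powr p \<le> c * (?I x * conv (\<rho> j) (\<lambda>y. norm (D y) powr p) x + ?I x * norm (D x) powr p)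
            + (c * e2 powr p) * (?I x * 1)" for x
        using le[of x] by (auto split: split_indicator)
    qed
    also have "\<dots> = c * ((LINT x|lebesgue. ?I x * conv (\<rho> j) (\<lambda>y. norm (D y) powr p) x)
        + (LINT x|lebesgue. ?I x * norm (D x) powr p)) + (c * e2 powr p) * B"
      unfolding B_def using i1 i2[of R] i3
      by (simp only: Bochner_Integration.integral_add Bochner_Integration.integrable_add
          integrable_mult_right integral_mult_right_zero)
    also have "\<dots> \<le> c * (e1 + e1) + c * (e / (4 * c))"
    proof -
      have m: "(LINT x|lebesgue. indicator (cball 0 S) x * norm (D x) powr p) \<le> e1" if "S \<le> R + 1" for S
      proof -
        have "(LINT x|lebesgue. indicator (cball 0 S) x * norm (D x) powr p)
            \<le> (LINT x|lebesgue. indicator (cball 0 (R + 1)) x * norm (D x) powr p)"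
          using that by (intro integral_mono i2) (auto split: split_indicator)
        then show ?thesis using ge unfolding D_def by linarith
      qed
      have "(LINT x|lebesgue. ?I x * conv (\<rho> j) (\<lambda>y. norm (D y) powr p) x) \<le> e1"
        by (rule order_trans[OF integral_conv_le[OF \<rho> Lp_loc_norm_powr[OF D]] m]) (use rj in auto)
      moreover have "(LINT x|lebesgue. ?I x * norm (D x) powr p) \<le> e1"
        by (rule m) simp
      ultimately show ?thesis
        using c0 e2(2) by (simp only: mult.assoc) (intro add_mono mult_left_mono, auto)
    qed
    also have "\<dots> < e"
      using c0 e by (simp add: e1_def field_simps)
    finally show "norm ((LINT x|lebesgue. ?I x * norm (conv (\<rho> j) F x - F x) powr p) - 0) < e"
      by (simp add: integral_nonneg_AE)
  qed
qed

section \<open>Uniqueness of weak gradients\<close>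

lemma mollifier_sequence:
  obtains \<rho> :: "nat \<Rightarrow> 'a::euclidean_space \<Rightarrow> real" where "\<And>j. mollifier (\<rho> j) (1 / real (Suc j))"
proof -
  have "\<forall>j. \<exists>\<rho> :: 'a \<Rightarrow> real. mollifier \<rho> (1 / real (Suc j))"
    by (intro allI mollifier_exists) simp
  then show ?thesis
    using that by (metis (no_types))
qed

lemma radius_tendsto_zero: "(\<lambda>j. 1 / real (Suc j)) \<longlonglongrightarrow> 0"
  using LIMSEQ_inverse_real_of_nat by (simp add: inverse_eq_divide)

text \<open>Both candidates mollify to the gradient of the mollified \<open>u\<close>, so their
  difference mollifies to 0; but its mollifications also converge locally in the mean to the
  difference itself.\<close>

lemma weak_gradient_unique:
  assumes G: "has_weak_gradient u G" and G': "has_weak_gradient u G'"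
  shows "AE x in lebesgue. G x = G' x"
proof -
  obtain \<rho> :: "nat \<Rightarrow> 'a \<Rightarrow> real" where \<rho>: "\<And>j. mollifier (\<rho> j) (1 / real (Suc j))"
    using mollifier_sequence by blast
  note t = mollifier_test_function[OF \<rho>]
  have GL: "Lp_loc 1 G" "Lp_loc 1 G'"
    using G G' by (auto simp: has_weak_gradient_def)
  define F where "F x = G x - G' x" for x
  have F: "Lp_loc 1 F"
    unfolding F_def using GL by (rule Lp_loc_diff) simp
  have "conv (\<rho> j) F x = 0" for j x
  proof -
    have "conv (\<rho> j) F x = conv (\<rho> j) G x - conv (\<rho> j) G' x"
      unfolding conv_def F_def scaleR_diff_right
      using integrable_conv[OF t GL(1)] integrable_conv[OF t GL(2)]
      by (subst Bochner_Integration.integral_diff) auto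
    then show ?thesis
      using gradient_conv[OF G t] gradient_conv[OF G' t] by simp
  qed
  then have z: "(LINT x|lebesgue. indicator (cball 0 R) x * norm (F x) powr 1) = 0" for R
    using conv_tendsto_Lp[OF F order_refl \<rho> radius_tendsto_zero, of R] by (simp add: LIMSEQ_const_iff)
  have "AE x in lebesgue. indicator (cball 0 (real n)) x * norm (F x) powr 1 = 0" for n
    using integral_nonneg_eq_0_iff_AE[OF Lp_loc_integrable[OF F, of "real n"]] z[of "real n"] by simp
  then have "AE x in lebesgue. \<forall>n. indicator (cball 0 (real n)) x * norm (F x) powr 1 = 0"
    unfolding AE_all_countable by blast
  then show ?thesis
  proof eventually_elim
    case (elim x)
    obtain n :: nat where "norm x \<le> real n"
      using real_arch_simple by blast
    then show ?case
      using elim[rule_format, of n] by (simp add: F_def)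
  qed
qed

section \<open>The anisotropic field\<close>

lemma gradient_inner_frechet: "f differentiable (at x) \<Longrightarrow> gradient f x \<bullet> b = frechet_derivative f (at x) b"
  using frechet_derivative_GDERIV[OF GDERIV_gradient] by metis

context
  fixes H :: "'a::euclidean_space \<Rightarrow> real"
  assumes H: "admissible_anisotropy H"
begin

lemma anisotropy_homogeneous: "0 < t \<Longrightarrow> H (t *\<^sub>R \<xi>) = t * H \<xi>"
  using H by (simp add: admissible_anisotropy_def)

lemma anisotropy_continuous: "continuous_on A H"
  using H continuous_on_subset by (auto simp: admissible_anisotropy_def)

lemma anisotropy_scale: "\<xi> \<noteq> 0 \<Longrightarrow> H \<xi> = norm \<xi> * H (\<xi> /\<^sub>R norm \<xi>)"
  using anisotropy_homogeneous[of "norm \<xi>" "\<xi> /\<^sub>R norm \<xi>"] by simp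

lemma anisotropy_pos:
  assumes "\<xi> \<noteq> 0"
  shows "0 < H \<xi>"
proof -
  have "\<xi> /\<^sub>R norm \<xi> \<in> sphere 0 1"
    using assms by simp
  then have "0 < H (\<xi> /\<^sub>R norm \<xi>)"
    using H unfolding admissible_anisotropy_def by blast
  then show ?thesis
    unfolding anisotropy_scale[OF assms] using assms by simp
qed

lemma anisotropy_differentiable: "\<xi> \<noteq> 0 \<Longrightarrow> H differentiable (at \<xi>)"
  using H by (simp add: admissible_anisotropy_def numeral_2_eq_2)

lemma anisotropy_gradient_continuous: "continuous_on (- {0}) (gradient H)"
proof (subst continuous_on_componentwise, intro ballI)
  fix b :: 'a assume b: "b \<in> Basis"
  have "continuous_on (- {0}) (\<lambda>x. frechet_derivative H (at x) b)"
    using H b by (auto simp: admissible_anisotropy_def numeral_2_eq_2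
        intro!: continuous_at_imp_continuous_on differentiable_imp_continuous_within)
  then show "continuous_on (- {0}) (\<lambda>x. gradient H x \<bullet> b)"
    by (rule continuous_on_cong[THEN iffD1, rotated 2])
       (auto simp: gradient_inner_frechet anisotropy_differentiable)
qed

lemma anisotropy_GDERIV: "\<xi> \<noteq> 0 \<Longrightarrow> GDERIV H \<xi> :> gradient H \<xi>"
  by (rule GDERIV_gradient[OF anisotropy_differentiable])

text \<open>\<open>\<lambda>x. H (t *\<^sub>R x)\<close> is differentiated in two ways: by the chain
  rule and as \<open>t * H x\<close>.\<close>

lemma anisotropy_gradient_homogeneous:
  assumes "\<xi> \<noteq> 0" "0 < t"
  shows "gradient H (t *\<^sub>R \<xi>) = gradient H \<xi>"
proof -
  have "GDERIV (\<lambda>x. H (t *\<^sub>R x)) \<xi> :> t *\<^sub>R gradient H (t *\<^sub>R \<xi>)"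
    using GDERIV_affine[of H t \<xi> 0 "gradient H (t *\<^sub>R \<xi>)"] anisotropy_GDERIV assms by simp
  moreover have "GDERIV (\<lambda>x. H (t *\<^sub>R x)) \<xi> :> t *\<^sub>R gradient H \<xi>"
    using GDERIV_mult[OF GDERIV_const anisotropy_GDERIV[OF assms(1)], of t]
    by (simp add: anisotropy_homogeneous[OF assms(2)])
  ultimately have "t *\<^sub>R gradient H (t *\<^sub>R \<xi>) = t *\<^sub>R gradient H \<xi>"
    using gradient_eqI by metis
  then show ?thesis using assms(2) by simp
qed

text \<open>Euler's identity: \<open>H\<close> is differentiated at \<open>s = 1\<close> along the
  ray \<open>s *\<^sub>R \<xi>\<close>, where it coincides with \<open>s * H \<xi>\<close> for
  \<open>s > 0\<close>.\<close>

lemma anisotropy_euler: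
  assumes "\<xi> \<noteq> 0"
  shows "gradient H \<xi> \<bullet> \<xi> = H \<xi>"
proof -
  have "((\<lambda>s::real. s *\<^sub>R \<xi>) has_derivative (\<lambda>s. s *\<^sub>R \<xi>)) (at 1)"
    by (auto intro!: derivative_eq_intros)
  moreover have "(H has_derivative (\<lambda>h. h \<bullet> gradient H \<xi>)) (at (1 *\<^sub>R \<xi>))"
    using anisotropy_GDERIV[OF assms] by (simp add: gderiv_def)
  ultimately have "((\<lambda>s. H (s *\<^sub>R \<xi>)) has_derivative (\<lambda>s. (s *\<^sub>R \<xi>) \<bullet> gradient H \<xi>)) (at 1)"
    by (rule has_derivative_compose)
  then have "((\<lambda>s. s * H \<xi>) has_derivative (\<lambda>s. (s *\<^sub>R \<xi>) \<bullet> gradient H \<xi>)) (at 1)"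
    by (rule has_derivative_transform_within_open[of _ _ _ UNIV "{0<..}"])
       (auto simp: anisotropy_homogeneous)
  moreover have "((\<lambda>s. s * H \<xi>) has_derivative (\<lambda>s. s * H \<xi>)) (at (1::real))"
    by (auto intro!: derivative_eq_intros)
  ultimately have "(\<lambda>s. (s *\<^sub>R \<xi>) \<bullet> gradient H \<xi>) = (\<lambda>s::real. s * H \<xi>)"
    by (rule has_derivative_unique)
  from fun_cong[OF this, of 1] show ?thesis by (simp add: inner_commute)
qed

lemma anisotropic_field_eq:
  assumes "\<xi> \<noteq> 0" "0 < p"
  shows "anisotropic_field H p \<xi> = H \<xi> powr (p - 1) *\<^sub>R gradient H \<xi>"
proof -
  have "((\<lambda>t. t powr p) has_field_derivative p * H \<xi> powr (p - 1)) (at (H \<xi>))"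
    using anisotropy_pos[OF assms(1)] by (auto intro!: derivative_eq_intros)
  from GDERIV_DERIV_compose[OF anisotropy_GDERIV[OF assms(1)] this]
  show ?thesis
    using assms by (simp add: anisotropic_field_def gradient_eqI)
qed

text \<open>Continuity is at hand only away from the origin, and the indicator extends by zero.
  Borel measurability is what permits composition with a merely Lebesgue measurable
  gradient.\<close>

lemma anisotropic_field_measurable:
  assumes "0 < p"
  shows "anisotropic_field H p \<in> borel_measurable borel"
proof -
  have "continuous_on (- {0}) (\<lambda>\<xi>. H \<xi> powr (p - 1) *\<^sub>R gradient H \<xi>)"
    using anisotropy_pos by (intro continuous_intros anisotropy_continuous anisotropy_gradient_continuous) force
  then have "(\<lambda>\<xi>. indicator (- {0}) \<xi> *\<^sub>R (H \<xi> powr (p - 1) *\<^sub>R gradient H \<xi>)) \<in> borel_measurable borel"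
    by (intro borel_measurable_continuous_on_indicator) auto
  moreover have "anisotropic_field H p = (\<lambda>\<xi>. indicator (- {0}) \<xi> *\<^sub>R (H \<xi> powr (p - 1) *\<^sub>R gradient H \<xi>))"
  proof
    fix \<xi>
    show "anisotropic_field H p \<xi> = indicator (- {0}) \<xi> *\<^sub>R (H \<xi> powr (p - 1) *\<^sub>R gradient H \<xi>)"
      using assms by (cases "\<xi> = 0") (simp add: anisotropic_field_def, simp add: anisotropic_field_eq)
  qed
  ultimately show ?thesis by simp
qed

text \<open>Scaling reduces everything to the unit sphere, where compactness bounds \<open>H\<close>
  away from 0 and bounds \<open>H\<close> and \<open>gradient H\<close> from above. By Euler's
  identity the pairing in the lower bound is \<open>H \<xi> powr p\<close>.\<close>

lemma anisotropic_field_bounds: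
  assumes "1 < p"
  obtains c C where "0 < c" "0 < C"
    "\<And>\<xi>. norm (anisotropic_field H p \<xi>) \<le> C * norm \<xi> powr (p - 1)"
    "\<And>\<xi>. c * norm \<xi> powr p \<le> anisotropic_field H p \<xi> \<bullet> \<xi>"
proof -
  have S: "compact (sphere (0::'a) 1)" "sphere (0::'a) 1 \<subseteq> - {0}" "sphere (0::'a) 1 \<noteq> {}"
    by auto
  obtain \<xi>0 where "\<xi>0 \<in> sphere 0 1" and h0: "\<And>\<xi>. \<xi> \<in> sphere 0 1 \<Longrightarrow> H \<xi>0 \<le> H \<xi>"
    using continuous_attains_inf[OF S(1,3) anisotropy_continuous] by blast
  then have h0_pos: "0 < H \<xi>0"
    by (intro anisotropy_pos) auto
  have "bounded (H ` sphere 0 1)" "bounded (gradient H ` sphere 0 1)"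
    using S anisotropy_continuous continuous_on_subset[OF anisotropy_gradient_continuous]
    by (auto intro!: compact_imp_bounded compact_continuous_image)
  then obtain h1 K where h1: "0 < h1" "\<And>\<xi>. \<xi> \<in> sphere 0 1 \<Longrightarrow> norm (H \<xi>) \<le> h1"
    and K: "0 < K" "\<And>\<xi>. \<xi> \<in> sphere 0 1 \<Longrightarrow> norm (gradient H \<xi>) \<le> K"
    unfolding bounded_pos by (metis imageI)
  have unit: "\<xi> /\<^sub>R norm \<xi> \<in> sphere 0 1" if "\<xi> \<noteq> 0" for \<xi> :: 'a
    using that by simp
  show ?thesis
  proof (rule that[of "H \<xi>0 powr p" "h1 powr (p - 1) * K"])
    fix \<xi> :: 'a
    show "norm (anisotropic_field H p \<xi>) \<le> h1 powr (p - 1) * K * norm \<xi> powr (p - 1)"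
    proof (cases "\<xi> = 0")
      case False
      have "H \<xi> \<le> h1 * norm \<xi>"
        using h1(2)[OF unit[OF False]] anisotropy_scale[OF False] mult_left_mono[of "H (\<xi> /\<^sub>R norm \<xi>)" h1 "norm \<xi>"]
        by (simp add: mult.commute)
      then have "H \<xi> powr (p - 1) \<le> h1 powr (p - 1) * norm \<xi> powr (p - 1)"
        using anisotropy_pos[OF False] assms h1(1) powr_mono2[of "p - 1" "H \<xi>" "h1 * norm \<xi>"]
        by (simp add: powr_mult)
      moreover have "norm (gradient H \<xi>) \<le> K"
        using K(2)[OF unit[OF False]] anisotropy_gradient_homogeneous[OF False, of "inverse (norm \<xi>)"] False
        by simp
      ultimately have "H \<xi> powr (p - 1) * norm (gradient H \<xi>) \<le> (h1 powr (p - 1) * norm \<xi> powr (p - 1)) * K"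
        by (intro mult_mono) auto
      then show ?thesis
        using False assms by (simp add: anisotropic_field_eq mult_ac)
    qed (simp add: anisotropic_field_def)
    show "H \<xi>0 powr p * norm \<xi> powr p \<le> anisotropic_field H p \<xi> \<bullet> \<xi>"
    proof (cases "\<xi> = 0")
      case False
      have "H \<xi>0 * norm \<xi> \<le> H \<xi>"
        using h0[OF unit[OF False]] anisotropy_scale[OF False] mult_left_mono[of "H \<xi>0" "H (\<xi> /\<^sub>R norm \<xi>)" "norm \<xi>"]
        by (simp add: mult.commute)
      then have "(H \<xi>0 * norm \<xi>) powr p \<le> H \<xi> powr p"
        using assms h0_pos by (intro powr_mono2) auto
      also have "H \<xi> powr p = H \<xi> powr (p - 1) * H \<xi>"
        using anisotropy_pos[OF False] by (simp add: powr_diff)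
      finally show ?thesis
        using False assms h0_pos by (simp add: anisotropic_field_eq anisotropy_euler powr_mult)
    qed (simp add: anisotropic_field_def)
  qed (use h0_pos h1 K in auto)
qed

end

section \<open>Young inequalities and limits of weighted integrals\<close>

text \<open>No conjugate exponents: depending on whether \<open>y \<le> s * x\<close>, one of the
  two terms alone dominates the left side. The constants are not sharp, but \<open>s\<close> may be
  taken small.\<close>

lemma young_powr:
  fixes x y s p :: real
  assumes "0 \<le> x" "0 \<le> y" "0 < s" "1 < p"
  shows "x powr (p - 1) * y \<le> s * x powr p + s powr (1 - p) * y powr p"
proof (cases "x = 0")
  case False
  then have x: "0 < x" using assms by simp
  show ?thesis
  proof (cases "y \<le> s * x")
    case True
    then have "x powr (p - 1) * y \<le> x powr (p - 1) * (s * x)"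
      by (intro mult_left_mono) auto
    also have "\<dots> = s * x powr p"
      using x by (simp add: powr_diff)
    also have "\<dots> \<le> \<dots> + s powr (1 - p) * y powr p"
      by simp
    finally show ?thesis .
  next
    case False
    then have y: "0 < y" "x \<le> y / s"
      using x assms mult_pos_pos[of s x] by (linarith, simp add: field_simps)
    then have "x powr (p - 1) * y \<le> (y / s) powr (p - 1) * y"
      using x assms by (intro mult_right_mono powr_mono2) auto
    also have "\<dots> = s powr (1 - p) * y powr p"
      using y assms by (simp add: powr_divide powr_diff)
    also have "\<dots> \<le> s * x powr p + \<dots>"
      using assms by simp
    finally show ?thesis .
  qed
qed auto

text \<open>The same dichotomy, now comparing \<open>2 * Y\<close> with
  \<open>X powr (1 - \<theta>)\<close>. The coefficient 1/2 of \<open>X\<close> is what later makes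
  absorption possible.\<close>

lemma young_theta:
  fixes X Y \<theta> :: real
  assumes "0 < X" "0 \<le> Y" "0 \<le> \<theta>" "\<theta> < 1"
  shows "X powr \<theta> * Y \<le> X / 2 + (2 * Y) powr (1 / (1 - \<theta>))"
proof (cases "2 * Y \<le> X powr (1 - \<theta>)")
  case True
  have "X powr \<theta> * Y \<le> X powr \<theta> * (X powr (1 - \<theta>) / 2)"
    using True by (intro mult_left_mono) auto
  also have "\<dots> = X / 2"
    using assms by (simp add: powr_add[symmetric])
  finally show ?thesis
    by (smt (verit) powr_ge_zero)
next
  case False
  then have Y: "0 < Y"
    using powr_ge_zero[of X "1 - \<theta>"] by linarith
  have "X = (X powr (1 - \<theta>)) powr (1 / (1 - \<theta>))"
    using assms by (simp add: powr_powr)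
  also have "\<dots> \<le> (2 * Y) powr (1 / (1 - \<theta>))"
    using False assms by (intro powr_mono2) auto
  finally have "X powr \<theta> * Y \<le> ((2 * Y) powr (1 / (1 - \<theta>))) powr \<theta> * (2 * Y)"
    using assms Y by (intro mult_mono powr_mono2) auto
  also have "\<dots> = (2 * Y) powr (\<theta> / (1 - \<theta>) + 1)"
    using Y by (simp add: powr_powr powr_add)
  also have "\<theta> / (1 - \<theta>) + 1 = 1 / (1 - \<theta>)"
    using assms by (simp add: field_simps)
  finally show ?thesis using assms(1) by simp
qed

lemma integrable_holder:
  assumes G: "Lp_loc p G" and D: "Lp_loc p D" and p: "1 < p"
  shows "integrable lebesgue (\<lambda>x. indicator (cball 0 R) x * (norm (G x) powr (p - 1) * norm (D x)))"
proof (rule Bochner_Integration.integrable_bound)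
  note [measurable] = Lp_loc_measurable[OF G] Lp_loc_measurable[OF D]
  have [measurable]: "cball 0 R \<in> sets lebesgue" by simp
  show "integrable lebesgue (\<lambda>x. indicator (cball 0 R) x * norm (G x) powr p + indicator (cball 0 R) x * norm (D x) powr p)"
    by (intro Bochner_Integration.integrable_add Lp_loc_integrable G D)
  show "(\<lambda>x. indicator (cball 0 R) x * (norm (G x) powr (p - 1) * norm (D x))) \<in> borel_measurable lebesgue"
    by measurable
  show "AE x in lebesgue. norm (indicator (cball 0 R) x * (norm (G x) powr (p - 1) * norm (D x)))
      \<le> norm (indicator (cball 0 R) x * norm (G x) powr p + indicator (cball 0 R) x * norm (D x) powr p)"
    using young_powr[OF norm_ge_zero norm_ge_zero zero_less_one p]
    by (auto split: split_indicator simp: abs_mult)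
qed

text \<open>Young's inequality with a small parameter instead of Hoelder's: \<open>s\<close> makes
  the \<open>G\<close> term at most \<open>e / 2\<close> for all \<open>j\<close>, and then the
  \<open>D j\<close> term drops below \<open>e / 2\<close> for large \<open>j\<close>.\<close>

lemma holder_tendsto_zero:
  assumes G: "Lp_loc p G" and D: "\<And>j. Lp_loc p (D j)" and p: "1 < p"
    and lim: "(\<lambda>j. LINT x|lebesgue. indicator (cball 0 R) x * norm (D j x) powr p) \<longlonglongrightarrow> 0"
  shows "(\<lambda>j. LINT x|lebesgue. indicator (cball 0 R) x * (norm (G x) powr (p - 1) * norm (D j x))) \<longlonglongrightarrow> 0"
proof (rule LIMSEQ_I)
  fix e :: real assume e: "0 < e"
  define I where "I = (LINT x|lebesgue. indicator (cball 0 R) x * norm (G x) powr p)"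
  have I0: "0 \<le> I" unfolding I_def by (intro integral_nonneg_AE) auto
  define s where "s = e / (2 * (I + 1))"
  have s: "0 < s" "s * I \<le> e / 2"
    using e I0 by (auto simp: s_def field_simps)
  have "(\<lambda>j. s powr (1 - p) * (LINT x|lebesgue. indicator (cball 0 R) x * norm (D j x) powr p)) \<longlonglongrightarrow> s powr (1 - p) * 0"
    by (intro tendsto_mult tendsto_const lim)
  then have "\<forall>\<^sub>F j in sequentially. s powr (1 - p) * (LINT x|lebesgue. indicator (cball 0 R) x * norm (D j x) powr p) < e / 2"
    using e by (intro order_tendstoD) auto
  then obtain j0 where j0: "\<And>j. j \<ge> j0 \<Longrightarrow>
      s powr (1 - p) * (LINT x|lebesgue. indicator (cball 0 R) x * norm (D j x) powr p) < e / 2"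
    unfolding eventually_sequentially by blast
  show "\<exists>j0. \<forall>j\<ge>j0. norm ((LINT x|lebesgue. indicator (cball 0 R) x * (norm (G x) powr (p - 1) * norm (D j x))) - 0) < e"
  proof (intro exI[of _ j0] allI impI)
    fix j assume j: "j0 \<le> j"
    have "(LINT x|lebesgue. indicator (cball 0 R) x * (norm (G x) powr (p - 1) * norm (D j x)))
        \<le> (LINT x|lebesgue. s * (indicator (cball 0 R) x * norm (G x) powr p)
            + s powr (1 - p) * (indicator (cball 0 R) x * norm (D j x) powr p))"
      by (intro integral_mono integrable_holder[OF G D p] Bochner_Integration.integrable_add
          integrable_mult_right Lp_loc_integrable G D)
         (use young_powr[OF norm_ge_zero norm_ge_zero s(1) p] in \<open>auto split: split_indicator\<close>)
    also have "\<dots> = s * I + s powr (1 - p) * (LINT x|lebesgue. indicator (cball 0 R) x * norm (D j x) powr p)"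
      unfolding I_def using Lp_loc_integrable[OF G, of R] Lp_loc_integrable[OF D, of R j] by simp
    also have "\<dots> < e"
      using s(2) j0[OF j] by linarith
    finally show "norm ((LINT x|lebesgue. indicator (cball 0 R) x * (norm (G x) powr (p - 1) * norm (D j x))) - 0) < e"
      by (simp add: integral_nonneg_AE)
  qed
qed

text \<open>Dominated convergence. As \<open>f\<close> vanishes outside the ball, the weights need a
  bound and a limit only inside it, where negative powers of mollifications are under
  control.\<close>

lemma tendsto_integral_weight:
  fixes f :: "'a::euclidean_space \<Rightarrow> real"
  assumes f: "integrable lebesgue f" and f0: "\<And>x. R < norm x \<Longrightarrow> f x = 0"
    and wc: "\<And>j. continuous_on UNIV (w j)" and vc: "continuous_on UNIV v"
    and B: "\<And>j x. norm x \<le> R \<Longrightarrow> \<bar>w j x\<bar> \<le> (B::real)"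
    and lim: "\<And>x. norm x \<le> R \<Longrightarrow> (\<lambda>j. w j x) \<longlonglongrightarrow> v x"
  shows "integrable lebesgue (\<lambda>x. w j x * f x)" "integrable lebesgue (\<lambda>x. v x * f x)"
    "(\<lambda>j. LINT x|lebesgue. w j x * f x) \<longlonglongrightarrow> (LINT x|lebesgue. v x * f x)"
proof -
  note [measurable] = continuous_borel_lebesgue[OF wc] continuous_borel_lebesgue[OF vc]
  have [measurable]: "f \<in> borel_measurable lebesgue" using f by auto
  have b: "integrable lebesgue (\<lambda>x. \<bar>B\<bar> * \<bar>f x\<bar>)" using f by simp
  have m: "(\<lambda>x. w j x * f x) \<in> borel_measurable lebesgue" "(\<lambda>x. v x * f x) \<in> borel_measurable lebesgue" for j
    by measurable
  have le: "AE x in lebesgue. norm (w j x * f x) \<le> \<bar>B\<bar> * \<bar>f x\<bar>" for j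
  proof (rule AE_I2)
    fix x show "norm (w j x * f x) \<le> \<bar>B\<bar> * \<bar>f x\<bar>"
    proof (cases "norm x \<le> R")
      case True
      have "\<bar>w j x\<bar> \<le> \<bar>B\<bar>" using B[OF True, of j] by linarith
      then show ?thesis by (simp add: abs_mult mult_right_mono)
    qed (simp add: f0)
  qed
  have l: "AE x in lebesgue. (\<lambda>j. w j x * f x) \<longlonglongrightarrow> v x * f x"
  proof (rule AE_I2)
    fix x show "(\<lambda>j. w j x * f x) \<longlonglongrightarrow> v x * f x"
      by (cases "norm x \<le> R") (auto intro!: tendsto_mult lim simp: f0)
  qed
  show "integrable lebesgue (\<lambda>x. w j x * f x)"
    by (rule integrable_dominated_convergence2[OF m(2) m(1) b l le])
  show "integrable lebesgue (\<lambda>x. v x * f x)"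
    by (rule integrable_dominated_convergence[OF m(2) m(1) b l le])
  show "(\<lambda>j. LINT x|lebesgue. w j x * f x) \<longlonglongrightarrow> (LINT x|lebesgue. v x * f x)"
    by (rule integral_dominated_convergence[OF m(2) m(1) b l le])
qed

section \<open>The energy inequality\<close>

lemma conv_tendsto_pointwise:
  assumes f: "continuous_on UNIV f" and \<rho>: "\<And>j. mollifier (\<rho> j) (r j)" and r: "r \<longlonglongrightarrow> 0"
  shows "(\<lambda>j. conv (\<rho> j) f x) \<longlonglongrightarrow> f x"
proof (rule LIMSEQ_I)
  fix e :: real assume e: "0 < e"
  have "isCont f x" using f by (simp add: continuous_on_eq_continuous_at)
  then obtain d where d: "0 < d" "\<And>y. norm (y - x) < d \<Longrightarrow> norm (f y - f x) < e / 2"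
    using e unfolding continuous_at_eps_delta dist_norm by (metis half_gt_zero)
  have "\<forall>\<^sub>F j in sequentially. r j < d"
    using r d(1) by (rule order_tendstoD)
  then obtain j0 where j0: "\<And>j. j \<ge> j0 \<Longrightarrow> r j < d"
    unfolding eventually_sequentially by blast
  have "norm (conv (\<rho> j) f x - f x) \<le> e / 2" if "j0 \<le> j" for j
  proof (rule mollifier_conv_close[OF \<rho> Lp_loc_continuous[OF f zero_le_one]])
    fix y assume "norm (y - x) < r j"
    then have "norm (y - x) < d" using j0[OF that] by linarith
    then show "norm (f y - f x) \<le> e / 2" using d(2) less_imp_le by blast
  qed
  then show "\<exists>j0. \<forall>j\<ge>j0. norm (conv (\<rho> j) f x - f x) < e"
    using e by (intro exI[of _ j0]) (fastforce intro: le_less_trans)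
qed

lemma mollifier_conv_pos:
  fixes u :: "'a::euclidean_space \<Rightarrow> real"
  assumes \<rho>: "mollifier \<rho> r" and u: "continuous_on UNIV u" and pos: "\<And>x. 0 < u x"
  shows "0 < conv \<rho> u x"
proof -
  \<comment> \<open>Strict positivity needs a positive lower bound on the whole averaging ball,
    hence compactness; \<open>\<bar>r\<bar>\<close> keeps the ball nonempty whatever the sign of
    \<open>r\<close>.\<close>
  have "compact (cball x \<bar>r\<bar>)" "cball x \<bar>r\<bar> \<noteq> {}" "continuous_on (cball x \<bar>r\<bar>) u"
    using u by (auto intro: continuous_on_subset)
  then obtain z where z: "\<And>y. y \<in> cball x \<bar>r\<bar> \<Longrightarrow> u z \<le> u y"
    using continuous_attains_inf by metis
  have "u z \<le> conv \<rho> u x"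
    by (rule mollifier_conv_ge[OF \<rho> Lp_loc_continuous[OF u zero_le_one]])
       (auto intro!: z simp: dist_norm norm_minus_commute)
  then show ?thesis using pos[of z] by linarith
qed

text \<open>\<open>W1p_loc\<close> provides some weak gradient with exponent \<open>p\<close>,
  whereas \<open>SOME\<close> may select another that is only known to be locally integrable; a.e.
  uniqueness transfers the exponent.\<close>

lemma weak_gradient_Lp_loc:
  assumes "u \<in> W1p_loc p"
  shows "has_weak_gradient u (weak_gradient u)" and "Lp_loc p (weak_gradient u)"
proof -
  obtain G where G: "has_weak_gradient u G" "Lp_loc p G"
    using assms by (auto simp: W1p_loc_def)
  from G(1) show w: "has_weak_gradient u (weak_gradient u)"
    unfolding weak_gradient_def using someI[of "has_weak_gradient u" G] by simp
  have m[measurable]: "weak_gradient u \<in> borel_measurable lebesgue"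
    using w by (simp add: has_weak_gradient_def Lp_loc_def)
  have ae: "AE x in lebesgue. G x = weak_gradient u x"
    by (rule weak_gradient_unique[OF G(1) w])
  show "Lp_loc p (weak_gradient u)"
    unfolding Lp_loc_def
  proof (intro conjI allI impI m)
    fix K :: "'a set" assume K: "compact K"
    then have [measurable]: "K \<in> sets lebesgue"
      by (simp add: compact_imp_closed)
    have "integrable lebesgue (\<lambda>x. indicator K x *\<^sub>R norm (G x) powr p)"
      using G(2) K by (simp add: Lp_loc_def set_integrable_def)
    then show "set_integrable lebesgue K (\<lambda>x. norm (weak_gradient u x) powr p)"
      unfolding set_integrable_def
    proof (rule Bochner_Integration.integrable_bound)
      show "AE x in lebesgue. norm (indicator K x *\<^sub>R norm (weak_gradient u x) powr p)
          \<le> norm (indicator K x *\<^sub>R norm (G x) powr p)"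
        using ae by eventually_elim simp
    qed measurable
  qed
qed

text \<open>Formally the inequality tested with \<open>u powr (- \<delta>) * \<zeta>\<close>, the
  derivative of the negative power supplying the energy with a favourable sign. Integrability
  belongs to the conclusion because a Bochner integral is 0 for a nonintegrable function, and the
  integrals are to be combined later.\<close>

lemma supersolution_energy:
  fixes H u \<zeta> :: "'a::euclidean_space \<Rightarrow> real"
  assumes sup: "positive_supersolution H p \<alpha> u" and H: "admissible_anisotropy H" and p: "1 < p"
    and \<delta>: "0 < \<delta>" and R: "0 < R"
    and \<zeta>: "smooth \<zeta>" and \<zeta>0: "\<And>x. 0 \<le> \<zeta> x" and \<zeta>R: "\<And>x. R < norm x \<Longrightarrow> \<zeta> x = 0"
  defines "G \<equiv> weak_gradient u"
  defines "V \<equiv> \<lambda>x. anisotropic_field H p (G x)"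
  shows "integrable lebesgue (\<lambda>x. u x powr (- \<delta>) * (u x powr \<alpha> * \<zeta> x))"
    and "integrable lebesgue (\<lambda>x. u x powr (- \<delta>) * (V x \<bullet> gradient \<zeta> x))"
    and "integrable lebesgue (\<lambda>x. u x powr (- \<delta> - 1) * (\<zeta> x * (V x \<bullet> G x)))"
    and "(LINT x|lebesgue. u x powr (- \<delta>) * (u x powr \<alpha> * \<zeta> x))
      \<le> (LINT x|lebesgue. u x powr (- \<delta>) * (V x \<bullet> gradient \<zeta> x))
        - \<delta> * (LINT x|lebesgue. u x powr (- \<delta> - 1) * (\<zeta> x * (V x \<bullet> G x)))"
proof -
  have uW: "u \<in> W1p_loc p" and uc: "continuous_on UNIV u" and upos: "\<And>x. 0 < u x"
    and ineq: "\<And>\<phi>. test_function \<phi> \<Longrightarrow> (\<And>x. 0 \<le> \<phi> x) \<Longrightarrow>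
        (LINT x|lebesgue. u x powr \<alpha> * \<phi> x) \<le> (LINT x|lebesgue. V x \<bullet> gradient \<phi> x)"
    using sup by (auto simp: positive_supersolution_def V_def G_def)
  note G = weak_gradient_Lp_loc[OF uW, folded G_def]
  have p0: "0 \<le> p" "1 \<le> p" "0 < p" using p by auto
  note uL = Lp_loc_continuous[OF uc zero_le_one]
  note Gm[measurable] = Lp_loc_measurable[OF G(2)]
  have Vm[measurable]: "V \<in> borel_measurable lebesgue"
    unfolding V_def by (rule measurable_compose[OF Gm anisotropic_field_measurable[OF H p0(3)]])
  obtain c C where C: "0 < C" "\<And>\<xi>. norm (anisotropic_field H p \<xi>) \<le> C * norm \<xi> powr (p - 1)"
    using anisotropic_field_bounds[OF H p] by metis
  obtain Z where Z: "0 \<le> Z" "\<And>x. norm (\<zeta> x) \<le> Z"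
    using bounded_if_support_bounded[OF smooth_continuous[OF \<zeta>, of UNIV], of R] \<zeta>R by blast
  have g\<zeta>R: "gradient \<zeta> x = 0" if "R < norm x" for x
    using gradient_zero_outside[of R \<zeta> x] \<zeta>R that by blast
  obtain Z' where Z': "0 \<le> Z'" "\<And>x. norm (gradient \<zeta> x) \<le> Z'"
    using bounded_if_support_bounded[OF smooth_gradient_continuous[OF \<zeta>, of UNIV], of R] g\<zeta>R by blast
  have \<zeta>m[measurable]: "\<zeta> \<in> borel_measurable lebesgue" "gradient \<zeta> \<in> borel_measurable lebesgue"
    using smooth_continuous[OF \<zeta>] smooth_gradient_continuous[OF \<zeta>] by (auto intro: continuous_borel_lebesgue)
  \<comment> \<open>Stated for a general field \<open>D\<close>, as both \<open>G\<close> and the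
    mollification error will be paired with \<open>V\<close>.\<close>
  have VD: "norm (\<zeta> x * (V x \<bullet> D x)) \<le> Z * C * (indicator (cball 0 R) x * (norm (G x) powr (p - 1) * norm (D x)))"
    for D :: "'a \<Rightarrow> 'a" and x
  proof (cases "norm x \<le> R")
    case True
    have "\<bar>V x \<bullet> D x\<bar> \<le> norm (V x) * norm (D x)"
      by (rule Cauchy_Schwarz_ineq2)
    also have "\<dots> \<le> (C * norm (G x) powr (p - 1)) * norm (D x)"
      using C(2)[of "G x"] by (intro mult_right_mono) (auto simp: V_def)
    finally have "\<bar>\<zeta> x\<bar> * \<bar>V x \<bullet> D x\<bar> \<le> Z * ((C * norm (G x) powr (p - 1)) * norm (D x))"
      using Z by (intro mult_mono) auto
    then show ?thesis using True by (simp add: abs_mult mult.assoc)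
  qed (simp add: \<zeta>R)
  have iVD: "integrable lebesgue (\<lambda>x. \<zeta> x * (V x \<bullet> D x))" if D: "Lp_loc p D" for D :: "'a \<Rightarrow> 'a"
  proof (rule Bochner_Integration.integrable_bound)
    note [measurable] = Lp_loc_measurable[OF D]
    show "integrable lebesgue (\<lambda>x. Z * C * (indicator (cball 0 R) x * (norm (G x) powr (p - 1) * norm (D x))))"
      by (intro integrable_mult_right integrable_holder G D p)
    show "(\<lambda>x. \<zeta> x * (V x \<bullet> D x)) \<in> borel_measurable lebesgue"
      by measurable
    show "AE x in lebesgue. norm (\<zeta> x * (V x \<bullet> D x))
        \<le> norm (Z * C * (indicator (cball 0 R) x * (norm (G x) powr (p - 1) * norm (D x))))"
      using VD[of _ D] by (intro AE_I2) (rule order_trans, assumption, simp)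
  qed
  define f1 where "f1 x = V x \<bullet> gradient \<zeta> x" for x
  define f2 where "f2 x = \<zeta> x * (V x \<bullet> G x)" for x
  define f3 where "f3 x = u x powr \<alpha> * \<zeta> x" for x
  have f0: "\<forall>x. R < norm x \<longrightarrow> f1 x = 0" "\<forall>x. R < norm x \<longrightarrow> f2 x = 0"
    "\<forall>x. R < norm x \<longrightarrow> f3 x = 0"
    using \<zeta>R g\<zeta>R by (auto simp: f1_def f2_def f3_def)
  have i1: "integrable lebesgue f1"
  proof (rule Bochner_Integration.integrable_bound)
    have "Lp_loc p (\<lambda>x::'a. 1::real)" by (rule Lp_loc_continuous[OF continuous_on_const p0(1)])
    from integrable_holder[OF G(2) this p, of R]
    show "integrable lebesgue (\<lambda>x. C * Z' * (indicator (cball 0 R) x * norm (G x) powr (p - 1)))"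
      by simp
    show "f1 \<in> borel_measurable lebesgue"
      unfolding f1_def by measurable
    have "norm (f1 x) \<le> C * Z' * (indicator (cball 0 R) x * norm (G x) powr (p - 1))" for x
    proof (cases "norm x \<le> R")
      case True
      have "\<bar>f1 x\<bar> \<le> norm (V x) * norm (gradient \<zeta> x)"
        unfolding f1_def by (rule Cauchy_Schwarz_ineq2)
      also have "\<dots> \<le> (C * norm (G x) powr (p - 1)) * Z'"
        using C Z' by (intro mult_mono) (auto simp: V_def)
      finally show ?thesis using True by (simp add: mult_ac)
    qed (simp add: f0)
    then show "AE x in lebesgue. norm (f1 x)
        \<le> norm (C * Z' * (indicator (cball 0 R) x * norm (G x) powr (p - 1)))"
      by (intro AE_I2) (rule order_trans, assumption, simp)
  qed
  have i2: "integrable lebesgue f2"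
    unfolding f2_def by (rule iVD[OF G(2)])
  have i3: "integrable lebesgue f3"
  proof (rule integrable_continuous_support)
    show "f3 x = 0" if "R < norm x" for x
      using f0(3) that by blast
    show "continuous_on UNIV f3"
      unfolding f3_def using upos
      by (intro continuous_intros uc smooth_continuous[OF \<zeta>]) (metis less_irrefl)
  qed
  obtain \<rho> :: "nat \<Rightarrow> 'a \<Rightarrow> real" where \<rho>: "\<And>j. mollifier (\<rho> j) (1 / real (Suc j))"
    using mollifier_sequence by blast
  note t = mollifier_test_function[OF \<rho>]
  define v where "v j = conv (\<rho> j) u" for j
  have vs: "smooth (v j)" for j
    unfolding v_def by (rule smooth_conv[OF t uL])
  have vpos: "0 < v j x" for j x
    unfolding v_def by (rule mollifier_conv_pos[OF \<rho> uc upos])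
  have vlim: "(\<lambda>j. v j x) \<longlonglongrightarrow> u x" for x
    unfolding v_def by (rule conv_tendsto_pointwise[OF uc \<rho> radius_tendsto_zero])
  \<comment> \<open>The mollifiers have radius at most 1, so on the ball of radius \<open>R\<close>
    the functions \<open>v j\<close> only average values of \<open>u\<close> from the ball of radius
    \<open>R + 1\<close>; the minimum of \<open>u\<close> there bounds them all from below.\<close>
  have "compact (cball (0::'a) (R + 1))" "cball (0::'a) (R + 1) \<noteq> {}" "continuous_on (cball 0 (R + 1)) u"
    using uc R by (auto intro: continuous_on_subset)
  then obtain x0 where x0: "\<And>y. y \<in> cball 0 (R + 1) \<Longrightarrow> u x0 \<le> u y"
    using continuous_attains_inf by metis
  define m where "m = u x0"
  have m: "0 < m" by (simp add: m_def upos)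
  have vm: "m \<le> v j x" if "norm x \<le> R" for j x
    unfolding v_def m_def
  proof (rule mollifier_conv_ge[OF \<rho> uL])
    fix y assume "norm (y - x) < 1 / real (Suc j)"
    also have "1 / real (Suc j) \<le> 1" by simp
    finally have "norm y \<le> R + 1"
      using that norm_triangle_ineq[of x "y - x"] by simp
    then show "u x0 \<le> u y" by (intro x0) simp
  qed
  have wc: "continuous_on UNIV (\<lambda>x. v j x powr s)" for j s
    using smooth_continuous[OF smooth_powr[OF vs vpos]] by blast
  have uwc: "continuous_on UNIV (\<lambda>x. u x powr s)" for s
    using upos by (intro continuous_intros uc) (metis less_irrefl)
  \<comment> \<open>For nonpositive exponents the lower bound \<open>m\<close> turns into an upper
    bound uniform in \<open>j\<close>.\<close>
  have wB: "\<bar>v j x powr s\<bar> \<le> m powr s" if "norm x \<le> R" "s \<le> 0" for j x s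
    using powr_mono2'[OF that(2) m vm[OF that(1)]] by simp
  have wlim: "(\<lambda>j. v j x powr s) \<longlonglongrightarrow> u x powr s" for x s
    using upos[of x] by (intro tendsto_powr vlim tendsto_const) simp
  have s0: "- \<delta> \<le> 0" "- \<delta> - 1 \<le> 0" using \<delta> by auto
  have W: "integrable lebesgue (\<lambda>x. v j x powr s * f x)" "integrable lebesgue (\<lambda>x. u x powr s * f x)"
    "(\<lambda>j. LINT x|lebesgue. v j x powr s * f x) \<longlonglongrightarrow> (LINT x|lebesgue. u x powr s * f x)"
    if "integrable lebesgue f" "\<forall>x. R < norm x \<longrightarrow> f x = 0" "s \<le> 0" for f s j
    using tendsto_integral_weight[of f R "\<lambda>j x. v j x powr s" "\<lambda>x. u x powr s" "m powr s"]
      that wc uwc wB wlim by blast+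
  note W1 = W[OF i1 f0(1) s0(1)] and W2 = W[OF i2 f0(2) s0(2)] and W3 = W[OF i3 f0(3) s0(1)]
  show "integrable lebesgue (\<lambda>x. u x powr (- \<delta>) * (u x powr \<alpha> * \<zeta> x))"
    using W3(2) by (simp add: f3_def)
  show "integrable lebesgue (\<lambda>x. u x powr (- \<delta>) * (V x \<bullet> gradient \<zeta> x))"
    using W1(2) by (simp add: f1_def)
  show "integrable lebesgue (\<lambda>x. u x powr (- \<delta> - 1) * (\<zeta> x * (V x \<bullet> G x)))"
    using W2(2) by (simp add: f2_def)
  define D where "D j x = conv (\<rho> j) G x - G x" for j x
  have convG: "Lp_loc p (conv (\<rho> j) G)" for j
    by (rule Lp_loc_continuous[OF continuous_on_conv[OF t Lp_loc_mono[OF G(2) p0(2)]] p0(1)])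
  have D: "Lp_loc p (D j)" for j
    unfolding D_def by (rule Lp_loc_diff[OF convG G(2) p0(1)])
  \<comment> \<open>The error from replacing \<open>conv (\<rho> j) G\<close> by \<open>G\<close> in
    the gradient of the test function.\<close>
  define E where "E j = (LINT x|lebesgue. v j x powr (- \<delta> - 1) * (\<zeta> x * (V x \<bullet> D j x)))" for j
  have iE: "integrable lebesgue (\<lambda>x. v j x powr (- \<delta> - 1) * (\<zeta> x * (V x \<bullet> D j x)))" for j
    using W(1)[OF iVD[OF D], of j "- \<delta> - 1" j] s0(2) \<zeta>R by simp
  have E0: "E \<longlonglongrightarrow> 0"
  proof (rule Lim_null_comparison)
    let ?h = "\<lambda>j x. indicator (cball 0 R) x * (norm (G x) powr (p - 1) * norm (D j x))"
    have "(\<lambda>j. LINT x|lebesgue. ?h j x) \<longlonglongrightarrow> 0"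
      using conv_tendsto_Lp[OF G(2) p0(2) \<rho> radius_tendsto_zero]
      by (intro holder_tendsto_zero[OF G(2) D p]) (simp add: D_def)
    then show "(\<lambda>j. m powr (- \<delta> - 1) * (Z * C) * (LINT x|lebesgue. ?h j x)) \<longlonglongrightarrow> 0"
      by (rule tendsto_mult_right_zero)
    have "norm (E j) \<le> m powr (- \<delta> - 1) * (Z * C) * (LINT x|lebesgue. ?h j x)" for j
    proof -
      have "norm (E j) \<le> (LINT x|lebesgue. m powr (- \<delta> - 1) * (Z * C) * ?h j x)"
        unfolding E_def
      proof (rule Bochner_Integration.integral_norm_bound_integral[OF iE])
        show "integrable lebesgue (\<lambda>x. m powr (- \<delta> - 1) * (Z * C) * ?h j x)"
          by (intro integrable_mult_right integrable_holder G D p)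
        fix x
        show "norm (v j x powr (- \<delta> - 1) * (\<zeta> x * (V x \<bullet> D j x))) \<le> m powr (- \<delta> - 1) * (Z * C) * ?h j x"
        proof (cases "norm x \<le> R")
          case True
          have "\<bar>v j x powr (- \<delta> - 1)\<bar> * \<bar>\<zeta> x * (V x \<bullet> D j x)\<bar>
              \<le> m powr (- \<delta> - 1) * (Z * C * ?h j x)"
            using wB[OF True s0(2)] VD[of x "D j"] by (intro mult_mono) auto
          then show ?thesis by (simp add: abs_mult mult.assoc)
        qed (simp add: \<zeta>R)
      qed
      then show ?thesis by simp
    qed
    then show "\<forall>\<^sub>F j in sequentially. norm (E j) \<le> m powr (- \<delta> - 1) * (Z * C) * (LINT x|lebesgue. ?h j x)"
      by simp
  qed
  have step: "(LINT x|lebesgue. v j x powr (- \<delta>) * f3 x) \<le> (LINT x|lebesgue. v j x powr (- \<delta>) * f1 x)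
      - \<delta> * ((LINT x|lebesgue. v j x powr (- \<delta> - 1) * f2 x) + E j)" for j
  proof -
    define \<phi> where "\<phi> x = v j x powr (- \<delta>) * \<zeta> x" for x
    have tf: "test_function \<phi>"
    proof (rule test_functionI)
      show "smooth \<phi>"
        unfolding \<phi>_def using Ck_on_mult smooth_powr[OF vs vpos] \<zeta> by blast
      show "\<phi> x = 0" if "R < norm x" for x
        using \<zeta>R[OF that] by (simp add: \<phi>_def)
    qed
    have g\<phi>: "gradient \<phi> x = v j x powr (- \<delta>) *\<^sub>R gradient \<zeta> x
        + \<zeta> x *\<^sub>R ((- \<delta> * v j x powr (- \<delta> - 1)) *\<^sub>R conv (\<rho> j) G x)" for x
    proof -
      have "GDERIV (v j) x :> conv (\<rho> j) G x"
        using smooth_GDERIV[OF vs[of j], of x] gradient_conv[OF G(1) t, of j x] by (simp add: v_def)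
      moreover have "((\<lambda>t. t powr (- \<delta>)) has_field_derivative - \<delta> * v j x powr (- \<delta> - 1)) (at (v j x))"
        using vpos[of j x] by (auto intro!: derivative_eq_intros)
      ultimately have "GDERIV (\<lambda>x. v j x powr (- \<delta>)) x :> (- \<delta> * v j x powr (- \<delta> - 1)) *\<^sub>R conv (\<rho> j) G x"
        by (rule GDERIV_DERIV_compose)
      from GDERIV_mult[OF this smooth_GDERIV[OF \<zeta>]] show ?thesis
        unfolding \<phi>_def by (rule gradient_eqI)
    qed
    have "(LINT x|lebesgue. v j x powr (- \<delta>) * f3 x) = (LINT x|lebesgue. u x powr \<alpha> * \<phi> x)"
      by (simp add: f3_def \<phi>_def mult_ac)
    also have "\<dots> \<le> (LINT x|lebesgue. V x \<bullet> gradient \<phi> x)"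
      by (rule ineq[OF tf]) (simp add: \<phi>_def \<zeta>0)
    also have "\<dots> = (LINT x|lebesgue. v j x powr (- \<delta>) * f1 x - \<delta> * (v j x powr (- \<delta> - 1) * f2 x
        + v j x powr (- \<delta> - 1) * (\<zeta> x * (V x \<bullet> D j x))))"
      by (rule Bochner_Integration.integral_cong)
         (simp_all add: g\<phi> f1_def f2_def D_def inner_add_right inner_diff_right algebra_simps)
    also have "\<dots> = (LINT x|lebesgue. v j x powr (- \<delta>) * f1 x)
        - \<delta> * ((LINT x|lebesgue. v j x powr (- \<delta> - 1) * f2 x) + E j)"
      unfolding E_def using W1(1)[of j] W2(1)[of j] iE[of j]
      by (simp only: Bochner_Integration.integral_diff Bochner_Integration.integral_add
          Bochner_Integration.integrable_add integrable_mult_right integral_mult_right_zero)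
    finally show ?thesis .
  qed
  have "(\<lambda>j. (LINT x|lebesgue. v j x powr (- \<delta>) * f1 x)
      - \<delta> * ((LINT x|lebesgue. v j x powr (- \<delta> - 1) * f2 x) + E j))
    \<longlonglongrightarrow> (LINT x|lebesgue. u x powr (- \<delta>) * f1 x)
      - \<delta> * ((LINT x|lebesgue. u x powr (- \<delta> - 1) * f2 x) + 0)"
    by (intro tendsto_diff tendsto_mult tendsto_add tendsto_const W1(3) W2(3) E0)
  from LIMSEQ_le[OF W3(3) this] step
  have "(LINT x|lebesgue. u x powr (- \<delta>) * f3 x) \<le> (LINT x|lebesgue. u x powr (- \<delta>) * f1 x)
      - \<delta> * ((LINT x|lebesgue. u x powr (- \<delta> - 1) * f2 x) + 0)"
    by blast
  then show "(LINT x|lebesgue. u x powr (- \<delta>) * (u x powr \<alpha> * \<zeta> x))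
      \<le> (LINT x|lebesgue. u x powr (- \<delta>) * (V x \<bullet> gradient \<zeta> x))
        - \<delta> * (LINT x|lebesgue. u x powr (- \<delta> - 1) * (\<zeta> x * (V x \<bullet> G x)))"
    by (simp add: f1_def f2_def f3_def)
qed

section \<open>Nonexistence\<close>

lemma bump_mono:
  assumes "s \<le> t"
  shows "bump s \<le> bump t"
proof (cases "0 < s")
  case True
  then have "inverse t \<le> inverse s"
    using assms by (intro le_imp_inverse_le) auto
  then show ?thesis using True assms by (simp add: bump_def)
qed (simp add: bump_def)

text \<open>If \<alpha> differs from \<open>p - 1\<close>, the relation determines \<theta> from
  \<delta>, and then \<open>p / (1 - \<theta>) = p * (\<alpha> - \<delta>) / (\<alpha> - (p -
  1))\<close>, whose size is tuned by \<delta>.\<close>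

lemma nonexistence_exponents:
  fixes p n \<alpha> :: real
  assumes p: "1 < p" "p < n" and \<alpha>: "\<alpha> < (n - 1) * p / (n - p) - 1"
  obtains \<delta> \<theta> where "0 < \<delta>" "0 \<le> \<theta>" "\<theta> < 1" "p - 1 - \<delta> = \<theta> * (\<alpha> - \<delta>)" "n < p / (1 - \<theta>)"
proof -
  consider "\<alpha> > p - 1" | "\<alpha> = p - 1" | "\<alpha> < p - 1" by linarith
  then show ?thesis
  proof cases
    case 1
    \<comment> \<open>Clearing denominators in
      \<open>n < p * (\<alpha> - \<delta>) / (\<alpha> - (p - 1))\<close> leaves
      \<open>p * \<delta> < \<kappa>\<close>; subcriticality says that \<kappa> is positive.\<close>
    define \<kappa> where "\<kappa> = n * (p - 1) - \<alpha> * (n - p)"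
    have "(\<alpha> + 1) * (n - p) < (n - 1) * p"
      using \<alpha> p by (simp add: field_simps)
    then have \<kappa>: "0 < \<kappa>" by (simp add: \<kappa>_def algebra_simps)
    \<comment> \<open>The first entry ensures \<open>p * \<delta> < \<kappa>\<close>, the second
      \<open>\<delta> < p - 1\<close> and hence a nonnegative \<theta>.\<close>
    define \<delta> where "\<delta> = min (\<kappa> / (2 * p)) ((p - 1) / 2)"
    have "0 < \<delta>" using \<kappa> p by (simp add: \<delta>_def)
    have d: "\<delta> < p - 1" using p by (simp add: \<delta>_def min_def)
    have "\<delta> \<le> \<kappa> / (2 * p)" by (simp add: \<delta>_def)
    then have "p * \<delta> \<le> \<kappa> / 2" using p by (simp add: field_simps)
    then have pd: "p * \<delta> < \<kappa>" using \<kappa> by linarith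
    have a: "0 < \<alpha> - \<delta>" using 1 d by linarith
    show ?thesis
    proof (rule that[of \<delta> "(p - 1 - \<delta>) / (\<alpha> - \<delta>)"])
      have "1 - (p - 1 - \<delta>) / (\<alpha> - \<delta>) = (\<alpha> - (p - 1)) / (\<alpha> - \<delta>)"
        using a by (simp add: field_simps)
      then have "p / (1 - (p - 1 - \<delta>) / (\<alpha> - \<delta>)) = p * (\<alpha> - \<delta>) / (\<alpha> - (p - 1))"
        by simp
      moreover have "n * (\<alpha> - (p - 1)) < p * (\<alpha> - \<delta>)"
        using pd by (simp add: \<kappa>_def algebra_simps)
      ultimately show "n < p / (1 - (p - 1 - \<delta>) / (\<alpha> - \<delta>))"
        using 1 by (simp add: pos_less_divide_eq)
    qed (use a d 1 \<open>0 < \<delta>\<close> in auto)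
  next
    case 2
    \<comment> \<open>With \<open>\<delta> = p - 1\<close> both sides of the relation vanish, so
      \<theta> is free; this choice gives \<open>p / (1 - \<theta>) = 2 * n\<close>.\<close>
    show ?thesis
      by (rule that[of "p - 1" "1 - p / (2 * n)"]) (use p 2 in \<open>auto simp: field_simps\<close>)
  next
    case 3
    define \<beta> where "\<beta> = p - 1 - \<alpha>"
    have \<beta>: "0 < \<beta>" using 3 by (simp add: \<beta>_def)
    \<comment> \<open>The solution of \<open>p / (1 - \<theta>) = p + n\<close>. Now
      \<open>p - 1 - \<delta>\<close> and \<open>\<alpha> - \<delta>\<close> are both negative, and
      \<theta> is their quotient.\<close>
    define \<delta> where "\<delta> = p - 1 + n * \<beta> / p"
    have nb: "0 < n * \<beta> / p" using \<beta> p by simp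
    have eq: "\<delta> - \<alpha> = \<beta> + n * \<beta> / p" "\<delta> - (p - 1) = n * \<beta> / p"
      by (auto simp: \<delta>_def \<beta>_def)
    show ?thesis
    proof (rule that[of \<delta> "(\<delta> - (p - 1)) / (\<delta> - \<alpha>)"])
      show "0 < \<delta>" using nb p by (simp add: \<delta>_def)
      show "0 \<le> (\<delta> - (p - 1)) / (\<delta> - \<alpha>)" "(\<delta> - (p - 1)) / (\<delta> - \<alpha>) < 1"
        unfolding eq using nb \<beta> by (simp_all only: divide_nonneg_pos add_pos_pos less_imp_le
            divide_less_eq_1_pos less_add_same_cancel2)
      have "\<delta> - \<alpha> \<noteq> 0" using eq nb \<beta> by linarith
      then show "p - 1 - \<delta> = (\<delta> - (p - 1)) / (\<delta> - \<alpha>) * (\<alpha> - \<delta>)"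
        by (simp add: field_simps)
      have "1 - (\<delta> - (p - 1)) / (\<delta> - \<alpha>) = \<beta> / (\<beta> + n * \<beta> / p)"
      proof -
        have "1 - w / (\<beta> + w) = \<beta> / (\<beta> + w)" if "0 < w" for w
          using that \<beta> by (simp add: field_simps)
        then show ?thesis unfolding eq using nb by blast
      qed
      then have "p / (1 - (\<delta> - (p - 1)) / (\<delta> - \<alpha>)) = p * (\<beta> + n * \<beta> / p) / \<beta>"
        by simp
      also have "\<dots> = p + n"
        using \<beta> p by (simp add: field_simps)
      finally show "n < p / (1 - (\<delta> - (p - 1)) / (\<delta> - \<alpha>))"
        using p by simp
    qed
  qed
qed

text \<open>The two applications of Young's inequality: the first absorbs the gradient term into the
  energy, and since \<open>p - 1 - \<delta> = \<theta> * (\<alpha> - \<delta>)\<close> the second absorbs the remaining power of \<open>U\<close>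
  into \<open>U powr (\<alpha> - \<delta>)\<close>.\<close>

lemma energy_absorption:
  fixes U e g X c C \<delta> \<theta> p \<alpha> :: real and k :: nat
  assumes p: "1 < p" and \<theta>: "0 \<le> \<theta>" "\<theta> < 1" and eq: "p - 1 - \<delta> = \<theta> * (\<alpha> - \<delta>)"
    and pos: "0 < \<delta>" "0 < c" "0 < C" and k: "2 \<le> k" "p / (1 - \<theta>) \<le> real k"
    and U: "0 < U" and e: "0 \<le> e" "e \<le> 1" and g: "0 \<le> g" and X: "0 \<le> X"
  defines "L \<equiv> real k * C * (\<delta> * c / (real k * C)) powr (1 - p)"
  shows "U powr (- \<delta>) * (C * X powr (p - 1) * (real k * e ^ (k - 1) * g))
      - \<delta> * (U powr (- \<delta> - 1) * (e ^ k * (c * X powr p)))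
    \<le> U powr (\<alpha> - \<delta>) * e ^ k / 2 + (2 * L) powr (1 / (1 - \<theta>)) * g powr (p / (1 - \<theta>))"
proof (cases "e = 0")
  case True
  \<comment> \<open>The quotient \<open>g / e\<close> used below is of no help here, but
    \<open>2 \<le> k\<close> makes both powers of \<open>e\<close> zero.\<close>
  have zero: "(0::real) ^ (k - 1) = 0" "(0::real) ^ k = 0" using k by auto
  show ?thesis unfolding True zero by simp
next
  case False
  then have e0: "0 < e" using e by simp
  \<comment> \<open>Makes \<open>real k * C * s = \<delta> * c\<close>, so that the first term of
    Young's inequality is exactly the energy being subtracted.\<close>
  define s where "s = \<delta> * c / (real k * C)"
  have kC: "0 < real k * C" using pos k by simp
  have s: "0 < s" unfolding s_def using pos kC by simp
  have L0: "0 \<le> L" unfolding L_def using kC by simp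
  \<comment> \<open>Shifts the missing factor \<open>e\<close> into the gradient, so that all terms
    carry the same weight \<open>e ^ k\<close>.\<close>
  define y where "y = g / e"
  have y: "0 \<le> y" using g e0 by (simp add: y_def)
  have ek: "e ^ (k - 1) * g = e ^ k * y"
    using k e0 by (cases k) (auto simp: y_def)
  have U1: "U powr (- \<delta>) = U powr (- \<delta> - 1) * U" "U powr (- \<delta> - 1) * U powr p = U powr (p - 1 - \<delta>)"
    using U powr_add[of U "- \<delta> - 1" 1] powr_add[of U "- \<delta> - 1" p] by (simp_all add: algebra_simps)
  have "X powr (p - 1) * (U * y) \<le> s * X powr p + s powr (1 - p) * (U * y) powr p"
    using X U y s p by (intro young_powr) auto
  then have "(real k * C * U powr (- \<delta> - 1) * e ^ k) * (X powr (p - 1) * (U * y))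
      \<le> (real k * C * U powr (- \<delta> - 1) * e ^ k) * (s * X powr p + s powr (1 - p) * (U * y) powr p)"
    using kC e0 by (intro mult_left_mono) auto
  also have "\<dots> = \<delta> * (U powr (- \<delta> - 1) * (e ^ k * (c * X powr p)))
      + e ^ k * (U powr (- \<delta> - 1) * U powr p * (L * y powr p))"
  proof -
    have "real k * C * s = \<delta> * c" using pos k by (simp add: s_def)
    then have "(real k * C * U powr (- \<delta> - 1) * e ^ k) * (s * X powr p)
        = \<delta> * (U powr (- \<delta> - 1) * (e ^ k * (c * X powr p)))"
      by (metis (no_types, lifting) mult.assoc mult.commute)
    moreover have "(U * y) powr p = U powr p * y powr p"
      using U y by (simp add: powr_mult)
    ultimately show ?thesis
      unfolding L_def s_def[symmetric] by (simp add: distrib_left mult_ac)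
  qed
  also have "(real k * C * U powr (- \<delta> - 1) * e ^ k) * (X powr (p - 1) * (U * y))
      = U powr (- \<delta>) * (C * X powr (p - 1) * (real k * e ^ (k - 1) * g))"
    using ek unfolding U1(1) by (simp add: mult_ac)
  finally have 1: "U powr (- \<delta>) * (C * X powr (p - 1) * (real k * e ^ (k - 1) * g))
      - \<delta> * (U powr (- \<delta> - 1) * (e ^ k * (c * X powr p)))
      \<le> e ^ k * (U powr (p - 1 - \<delta>) * (L * y powr p))"
    unfolding U1(2) by linarith
  have "U powr (p - 1 - \<delta>) = (U powr (\<alpha> - \<delta>)) powr \<theta>"
    unfolding eq by (simp add: powr_powr mult.commute)
  then have "U powr (p - 1 - \<delta>) * (L * y powr p) \<le> U powr (\<alpha> - \<delta>) / 2 + (2 * (L * y powr p)) powr (1 / (1 - \<theta>))"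
    using young_theta[of "U powr (\<alpha> - \<delta>)" "L * y powr p" \<theta>] U L0 \<theta> by simp
  also have "(2 * (L * y powr p)) powr (1 / (1 - \<theta>)) = (2 * L) powr (1 / (1 - \<theta>)) * y powr (p / (1 - \<theta>))"
    using L0 by (simp add: powr_mult powr_powr mult.assoc[symmetric])
  finally have "e ^ k * (U powr (p - 1 - \<delta>) * (L * y powr p))
      \<le> e ^ k * (U powr (\<alpha> - \<delta>) / 2 + (2 * L) powr (1 / (1 - \<theta>)) * y powr (p / (1 - \<theta>)))"
    using e0 by (intro mult_left_mono) auto
  also have "\<dots> = U powr (\<alpha> - \<delta>) * e ^ k / 2 + (2 * L) powr (1 / (1 - \<theta>)) * (e ^ k * y powr (p / (1 - \<theta>)))"
    by (simp add: distrib_left mult_ac)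
  \<comment> \<open>As \<open>e \<le> 1\<close> and \<open>k\<close> is at least the exponent,
    \<open>e ^ k\<close> makes up for the division by \<open>e\<close> hidden in
    \<open>y\<close>.\<close>
  also have "e ^ k * y powr (p / (1 - \<theta>)) \<le> g powr (p / (1 - \<theta>))"
  proof -
    have "e ^ k = e powr real k" using e0 by (simp add: powr_realpow)
    also have "\<dots> \<le> e powr (p / (1 - \<theta>))"
      using powr_mono'[OF k(2) e(1,2)] .
    finally have "e ^ k * y powr (p / (1 - \<theta>)) \<le> e powr (p / (1 - \<theta>)) * y powr (p / (1 - \<theta>))"
      by (intro mult_right_mono) auto
    also have "\<dots> = g powr (p / (1 - \<theta>))"
      using e0 g by (simp add: y_def powr_divide)
    finally show ?thesis .
  qed
  finally show ?thesis
    using 1 by (simp add: mult_left_mono)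
qed

theorem supersolution_nonexistence:
  fixes H u :: "'a::euclidean_space \<Rightarrow> real"
  assumes p: "1 < p" "p < real DIM('a)" and H: "admissible_anisotropy H"
    and \<alpha>: "\<alpha> < (real DIM('a) - 1) * p / (real DIM('a) - p) - 1"
  shows "\<not> positive_supersolution H p \<alpha> u"
proof
  assume sup: "positive_supersolution H p \<alpha> u"
  then have uc: "continuous_on UNIV u" and upos: "\<And>x. 0 < u x"
    by (auto simp: positive_supersolution_def)
  obtain \<delta> \<theta> where \<delta>: "0 < \<delta>" and \<theta>: "0 \<le> \<theta>" "\<theta> < 1"
    and eq: "p - 1 - \<delta> = \<theta> * (\<alpha> - \<delta>)" and n: "real DIM('a) < p / (1 - \<theta>)"
    using nonexistence_exponents[OF p \<alpha>] by metis
  define q where "q = p / (1 - \<theta>)"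
  obtain c C where c: "0 < c" and C: "0 < C"
    and Cb: "\<And>\<xi>. norm (anisotropic_field H p \<xi>) \<le> C * norm \<xi> powr (p - 1)"
    and cb: "\<And>\<xi>. c * norm \<xi> powr p \<le> anisotropic_field H p \<xi> \<bullet> \<xi>"
    using anisotropic_field_bounds[OF H p(1)] by metis
  obtain k0 :: nat where "q \<le> real k0" using real_arch_simple by blast
  then obtain k :: nat where k: "2 \<le> k" "q \<le> real k"
    by (metis max.cobounded1 max.cobounded2 of_nat_le_iff order_trans)
  \<comment> \<open>A radially decreasing profile without a plateau:
    \<open>\<eta> ((1 / R) *\<^sub>R x)\<close> increases with \<open>R\<close>, which is enough to
    compare \<open>J 1\<close> with \<open>J R\<close>.\<close>
  define \<eta> :: "'a \<Rightarrow> real" where "\<eta> x = bump (4 - x \<bullet> x)" for x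
  have \<eta>: "smooth \<eta>" unfolding \<eta>_def by (rule smooth_radial_bump)
  have \<eta>0: "\<eta> x = 0" if "2 < norm x" for x
  proof -
    have "2 * 2 \<le> norm x * norm x" using that by (intro mult_mono) auto
    then show ?thesis by (simp add: \<eta>_def dot_square_norm power2_eq_square)
  qed
  have \<eta>1: "0 \<le> \<eta> x" "\<eta> x \<le> 1" for x by (auto simp: \<eta>_def)
  obtain N where N: "0 \<le> N" "\<And>x. norm (gradient \<eta> x) \<le> N"
    using bounded_if_support_bounded[OF smooth_gradient_continuous[OF \<eta>, of UNIV], of 2]
      gradient_zero_outside[of 2 \<eta>] \<eta>0 by blast
  define L where "L = real k * C * (\<delta> * c / (real k * C)) powr (1 - p)"
  define M where "M = (2 * L) powr (1 / (1 - \<theta>))"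
  have M0: "0 \<le> M" by (simp add: M_def)
  have uwc: "continuous_on UNIV (\<lambda>x. u x powr s)" for s
    using upos by (intro continuous_intros uc) (metis less_irrefl)
  define J where "J R = (LINT x|lebesgue. u x powr (\<alpha> - \<delta>) * \<eta> ((1 / R) *\<^sub>R x) ^ k)" for R
  have \<eta>R: "\<eta> ((1 / R) *\<^sub>R x) = 0" if "0 < R" "2 * R < norm x" for R x
    using that by (intro \<eta>0) (simp add: field_simps)
  have \<eta>Rs: "smooth (\<lambda>x. \<eta> ((1 / R) *\<^sub>R x))" for R
    using Ck_on_affine[of _ \<eta> "1 / R" 0] \<eta> by simp
  have iJ: "integrable lebesgue (\<lambda>x. u x powr (\<alpha> - \<delta>) * \<eta> ((1 / R) *\<^sub>R x) ^ k)" if R: "0 < R" for R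
  proof (rule integrable_continuous_support[where R="2 * R"])
    show "continuous_on UNIV (\<lambda>x. u x powr (\<alpha> - \<delta>) * \<eta> ((1 / R) *\<^sub>R x) ^ k)"
      by (intro continuous_on_mult uwc continuous_on_power smooth_continuous[OF \<eta>Rs])
    show "u x powr (\<alpha> - \<delta>) * \<eta> ((1 / R) *\<^sub>R x) ^ k = 0" if "2 * R < norm x" for x
      using \<eta>R[OF R that] k by simp
  qed
  \<comment> \<open>\<open>J R\<close> is finite because the cutoff has compact support, so the
    absorbed half may be subtracted; this produces the factor 2.\<close>
  have J_upper: "J R \<le> 2 * (M * (N / R) powr q * measure lborel (cball (0::'a) (2 * R)))" if R: "0 < R" for R
  proof -
    define e where "e x = \<eta> ((1 / R) *\<^sub>R x)" for x
    define \<zeta> where "\<zeta> x = e x ^ k" for x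
    have es: "smooth e" unfolding e_def by (rule \<eta>Rs)
    have e1: "0 \<le> e x" "e x \<le> 1" for x by (auto simp: e_def \<eta>1)
    have ge: "norm (gradient e x) \<le> N / R" for x
    proof -
      have "GDERIV e x :> (1 / R) *\<^sub>R gradient \<eta> ((1 / R) *\<^sub>R x)"
        using GDERIV_affine[of \<eta> "1 / R" x 0] smooth_GDERIV[OF \<eta>] by (simp add: e_def[abs_def])
      then show ?thesis
        using N(2)[of "(1 / R) *\<^sub>R x"] R by (simp add: gradient_eqI divide_right_mono)
    qed
    have ge0: "gradient e x = 0" if "2 * R < norm x" for x
      using gradient_zero_outside[of "2 * R" e x] that \<eta>R[OF R] by (simp add: e_def)
    have g\<zeta>: "gradient \<zeta> x = (real k * e x ^ (k - 1)) *\<^sub>R gradient e x" for x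
    proof -
      have "((\<lambda>t. t ^ k) has_field_derivative real k * e x ^ (k - 1)) (at (e x))"
        by (auto intro!: derivative_eq_intros)
      from GDERIV_DERIV_compose[OF smooth_GDERIV[OF es] this]
      show ?thesis unfolding \<zeta>_def by (rule gradient_eqI)
    qed
    have \<zeta>: "smooth \<zeta>" "\<And>x. 0 \<le> \<zeta> x" "\<And>x. 2 * R < norm x \<Longrightarrow> \<zeta> x = 0"
      using es Ck_on_power e1 \<eta>R[OF R] k unfolding \<zeta>_def by (blast, simp, simp add: e_def)
    have R2: "0 < 2 * R" using R by simp
    note E = supersolution_energy[OF sup H p(1) \<delta> R2 \<zeta>]
    let ?G = "weak_gradient u" and ?V = "\<lambda>x. anisotropic_field H p (weak_gradient u x)"
    let ?I = "indicator (cball 0 (2 * R)) :: 'a \<Rightarrow> real"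
    have upow: "u x powr (- \<delta>) * (u x powr \<alpha> * \<zeta> x) = u x powr (\<alpha> - \<delta>) * \<zeta> x" for x
      using upos[of x] by (simp add: powr_diff powr_minus field_simps)
    \<comment> \<open>The indicator keeps the constant bound on the gradient integrable; outside the
      ball the cutoff and its gradient vanish.\<close>
    have pointwise: "u x powr (- \<delta>) * (?V x \<bullet> gradient \<zeta> x) - \<delta> * (u x powr (- \<delta> - 1) * (\<zeta> x * (?V x \<bullet> ?G x)))
        \<le> u x powr (\<alpha> - \<delta>) * \<zeta> x / 2 + M * (N / R) powr q * ?I x" for x
    proof (cases "norm x \<le> 2 * R")
      case True
      have "?V x \<bullet> gradient \<zeta> x \<le> norm (?V x) * norm (gradient \<zeta> x)"
        by (rule norm_cauchy_schwarz)
      also have "norm (gradient \<zeta> x) = real k * e x ^ (k - 1) * norm (gradient e x)"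
        using e1 by (simp add: g\<zeta>)
      also have "norm (?V x) * \<dots> \<le> C * norm (?G x) powr (p - 1) * (real k * e x ^ (k - 1) * norm (gradient e x))"
        using Cb e1 by (intro mult_right_mono) auto
      finally have a: "u x powr (- \<delta>) * (?V x \<bullet> gradient \<zeta> x)
          \<le> u x powr (- \<delta>) * (C * norm (?G x) powr (p - 1) * (real k * e x ^ (k - 1) * norm (gradient e x)))"
        by (intro mult_left_mono) auto
      have b: "\<delta> * (u x powr (- \<delta> - 1) * (e x ^ k * (c * norm (?G x) powr p)))
          \<le> \<delta> * (u x powr (- \<delta> - 1) * (\<zeta> x * (?V x \<bullet> ?G x)))"
        unfolding \<zeta>_def using cb[of "?G x"] \<delta> e1 by (intro mult_left_mono) auto
      have "M * norm (gradient e x) powr q \<le> M * (N / R) powr q"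
        using M0 ge p \<theta> by (intro mult_left_mono powr_mono2) (auto simp: q_def)
      then show ?thesis
        using a b True energy_absorption[where e="e x" and g="norm (gradient e x)"
            and X="norm (?G x)", OF p(1) \<theta> eq \<delta> c C k(1) _ upos[of x] e1 norm_ge_zero norm_ge_zero] k(2)
        unfolding M_def L_def \<zeta>_def q_def by simp
    next
      case False
      then show ?thesis
        using \<zeta>(3)[of x] ge0[of x] by (simp add: g\<zeta>)
    qed
    have iI: "integrable lebesgue (\<lambda>x. M * (N / R) powr q * ?I x)"
      using integrable_indicator_cball[of "2 * R" "M * (N / R) powr q"] by (simp add: mult.commute)
    have i1: "integrable lebesgue (\<lambda>x. u x powr (\<alpha> - \<delta>) * \<zeta> x / 2)"
      using iJ[OF R] by (simp add: \<zeta>_def e_def)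
    have "J R = (LINT x|lebesgue. u x powr (- \<delta>) * (u x powr \<alpha> * \<zeta> x))"
      unfolding J_def upow by (simp add: \<zeta>_def e_def)
    also have "\<dots> \<le> (LINT x|lebesgue. u x powr (- \<delta>) * (?V x \<bullet> gradient \<zeta> x))
        - \<delta> * (LINT x|lebesgue. u x powr (- \<delta> - 1) * (\<zeta> x * (?V x \<bullet> ?G x)))"
      by (rule E(4))
    also have "\<dots> = (LINT x|lebesgue. u x powr (- \<delta>) * (?V x \<bullet> gradient \<zeta> x)
        - \<delta> * (u x powr (- \<delta> - 1) * (\<zeta> x * (?V x \<bullet> ?G x))))"
      using E(2,3) by (simp only: Bochner_Integration.integral_diff integrable_mult_right integral_mult_right_zero)
    also have "\<dots> \<le> (LINT x|lebesgue. u x powr (\<alpha> - \<delta>) * \<zeta> x / 2 + M * (N / R) powr q * ?I x)"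
      by (intro integral_mono Bochner_Integration.integrable_diff integrable_mult_right E(2,3)
          Bochner_Integration.integrable_add i1 iI pointwise)
    also have "\<dots> = J R / 2 + M * (N / R) powr q * measure lborel (cball (0::'a) (2 * R))"
      using i1 iI by (simp add: J_def \<zeta>_def e_def)
    finally show ?thesis by simp
  qed
  have J_lower: "J 1 \<le> J R" if R: "1 \<le> R" for R
    unfolding J_def
  proof (rule integral_mono)
    show "u x powr (\<alpha> - \<delta>) * \<eta> ((1 / 1) *\<^sub>R x) ^ k \<le> u x powr (\<alpha> - \<delta>) * \<eta> ((1 / R) *\<^sub>R x) ^ k" for x
    proof (intro mult_left_mono power_mono)
      have "norm ((1 / R) *\<^sub>R x) \<le> norm x"
        using R by (simp add: divide_le_eq mult_right_mono mult_le_cancel_left1)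
      then have "((1 / R) *\<^sub>R x) \<bullet> ((1 / R) *\<^sub>R x) \<le> x \<bullet> x"
        unfolding dot_square_norm by (intro power_mono) auto
      then show "\<eta> ((1 / 1) *\<^sub>R x) \<le> \<eta> ((1 / R) *\<^sub>R x)"
        unfolding \<eta>_def by (intro bump_mono) simp
    qed (auto simp: \<eta>1)
  qed (use iJ[of 1] iJ[of R] R in auto)
  have J1: "0 < J 1"
    unfolding J_def
  proof (rule integral_pos_continuous[where R=2 and a=0])
    show "continuous_on UNIV (\<lambda>x. u x powr (\<alpha> - \<delta>) * \<eta> ((1 / 1) *\<^sub>R x) ^ k)"
      by (intro continuous_on_mult uwc continuous_on_power smooth_continuous[OF \<eta>Rs])
    show "0 < u 0 powr (\<alpha> - \<delta>) * \<eta> ((1 / 1) *\<^sub>R 0) ^ k"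
      using upos[of 0] by (simp add: \<eta>_def)
  qed (use \<eta>0 \<eta>1 k in auto)
  \<comment> \<open>Collects everything independent of \<open>R\<close>: the gradient of the cutoff
    contributes \<open>R powr (- q)\<close>, and the volume of the ball contributes \<open>R\<close>
    to the power of the dimension.\<close>
  define K where "K = 2 * (M * N powr q * (unit_ball_vol (real DIM('a)) * 2 ^ DIM('a)))"
  have bound: "J 1 \<le> K * R powr (real DIM('a) - q)" if R: "1 \<le> R" for R
  proof -
    have "J 1 \<le> 2 * (M * (N / R) powr q * measure lborel (cball (0::'a) (2 * R)))"
      using J_lower[OF R] J_upper[of R] R by linarith
    also have "measure lborel (cball (0::'a) (2 * R)) = unit_ball_vol (real DIM('a)) * (2 ^ DIM('a) * R powr real DIM('a))"
      using R by (simp add: content_cball power_mult_distrib powr_realpow)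
    also have "(N / R) powr q = N powr q * R powr (- q)"
      using N(1) R by (simp add: powr_divide powr_minus_divide)
    finally have "J 1 \<le> K * (R powr (- q) * R powr real DIM('a))"
      by (simp add: K_def mult_ac)
    then show ?thesis
      by (simp add: powr_add[symmetric])
  qed
  have "((\<lambda>R::real. K * R powr (real DIM('a) - q)) \<longlongrightarrow> K * 0) at_top"
    using n by (intro tendsto_mult tendsto_const tendsto_neg_powr filterlim_ident) (simp add: q_def)
  moreover have "\<forall>\<^sub>F R in at_top. J 1 \<le> K * R powr (real DIM('a) - q)"
    using eventually_ge_at_top[of 1] by eventually_elim (rule bound)
  ultimately have "J 1 \<le> K * 0"
    by (intro tendsto_lowerbound) auto
  then show False using J1 by simp
qed

theorem corollary1p2:
  fixes H :: "real ^ 'n \<Rightarrow> real" and p \<alpha> :: real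
  assumes "CARD('n) \<ge> 2"
    and "1 < p" and "p < real CARD('n)"
    and "admissible_anisotropy H"
    and "\<alpha> < (real CARD('n) - 1) * p / (real CARD('n) - p) - 1"
  shows "\<not> (\<exists>u. positive_supersolution H p \<alpha> u)"
  using supersolution_nonexistence[of p H \<alpha>] assms by simp

end
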